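(* Let $(\Omega,\mathcal A,\mu)$ be a $\sigma$-finite measure space with a filtration by partitions $\{\mathcal Q_n : n\in\mathbb Z\}$, and $\mathcal Q=\bigcup_{n}\mathcal Q_n$, as described in the context. There is a constant $C>0$ such that for every $Q_0\in\mathcal Q$, every function $f\in L^1(\mu)$ supported on $Q_0$, and every martingale transform $T$, there is a sparse operator $\mathsf S=\mathsf S_{T,f}$ such that $$\mathbf 1_{Q_0}\,\lvert Tf\rvert \le C\cdot \mathsf S\lvert f\rvert .$$ The same holds for the maximal truncations $T_\sharp$: for every such $Q_0$, $f$ and $T$ there is a sparse operator $\mathsf S=\mathsf S_{T,f}$ such that $\mathbf 1_{Q_0} T_\sharp f\le C\cdot\mathsf S\lvert f\rvert$.
   Context: Setting. $(\Omega,\mathcal A,\mu)$ is a $\sigma$-finite measure space and $\{\mathcal Q_n : n\in\mathbb Z\}$ are collections of measurable sets, $\mathcal Q_n\subset\mathcal A$, such that: (1) each $\mathcal Q_n$ is a partition of $\Omega$, and $0<\mu(Q)<\infty$ for all $Q\in\mathcal Q_n$; (2) for each $n$ and each $Q\in\mathcal Q_n$, the set $Q$ is a union of sets $Q'\in\mathcal Q_{n+1}$ (and $Q'=Q$ is allowed); (3) the collection $\mathcal Q:=\bigcup_{n\in\mathbb Z}\mathcal Q_n$ generates $\mathcal A$. The branching is allowed to be unbounded. Notation. $\langle f\rangle_Q:=\mu(Q)^{-1}\int_Q f\,d\mu$. For $Q\in\mathcal Q$, the parent $Q^a$ is the minimal element of $\mathcal Q$ which strictly contains $Q$; the children of $P\in\mathcal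 Q$ are $\mathrm{ch}(P):=\{Q\in\mathcal Q: Q^a=P\}$. The martingale difference associated with $P\in\mathcal Q$ is $$\Delta_P f:=\sum_{Q\in\mathrm{ch}(P)}\mathbf 1_Q\,(\langle f\rangle_Q-\langle f\rangle_P).$$ Martingale transform. An operator of the form $Tf=\sum_{P\in\mathcal Q}\epsilon_P\Delta_P f$ with scalars $\lvert\epsilon_P\rvert\le 1$. (At a point $x$ only the $P$ containing $x$, which form a chain under inclusion, contribute; $Tf(x)$ is the limit of the partial sums taken in the order of this chain, for $\mu$-almost every $x$.) Maximal truncations. $$T_\sharp f:=\sup_{Q'\in\mathcal Q}\Bigl\lvert\sum_{Q\in\mathcal Q,\ Q\supset Q'}\epsilon_Q\Delta_Q f\Bigr\rvert .$$ Sparse operator. An operator of the form $\mathsf S f=\sum_{P\in\mathcal S}\langle f\rangle_P\mathbf 1_P$, where $\mathcal S\subset\mathcal Q$ satisfies, for each $P\in\mathcal S$, $$\sum_{Q\in\mathrm{ch}_{\mathcal S}(P)}\mu(Q)\le\tfrac12\mu(P),$$ where $\mathrm{ch}_{\mathcal S}(P)$ denotes the $\mathcal S$-children of $P$: the maximal elements of $\mathcal S$ that are strictly contained in $P$. Inequalities between functions are understood $\mu$-almost everywhere. *)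

theory Defs
  imports "HOL-Analysis.Analysis"
begin

locale partition_filtration = sigma_finite_measure M
  for M :: "'a measure" and \<Q> :: "int \<Rightarrow> 'a set set" +
  assumes measurable_cells: "\<And>n. \<Q> n \<subseteq> sets M"
    and partition_cells: "\<And>n. partition_on (space M) (\<Q> n)"
    and emeasure_cells: "\<And>n Q. Q \<in> \<Q> n \<Longrightarrow> 0 < emeasure M Q \<and> emeasure M Q < \<infinity>"
    and refine_cells: "\<And>n Q. Q \<in> \<Q> n \<Longrightarrow> \<exists>\<A>. \<A> \<subseteq> \<Q> (n + 1) \<and> Q = \<Union>\<A>"
    and generate_cells: "sets M = sigma_sets (space M) (\<Union>n. \<Q> n)"

definition cells :: "(int \<Rightarrow> 'a set set) \<Rightarrow> 'a set set" where
  "cells \<Q> = (\<Union>n. \<Q> n)"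

definition average :: "'a measure \<Rightarrow> ('a \<Rightarrow> 'b::{banach, second_countable_topology}) \<Rightarrow> 'a set \<Rightarrow> 'b" where
  "average M f Q = (1 / measure M Q) *\<^sub>R (LINT x:Q|M. f x)"

text \<open>A relation rather than a function, because a cell that is maximal in the whole collection has
  no parent.\<close>

definition is_parent :: "(int \<Rightarrow> 'a set set) \<Rightarrow> 'a set \<Rightarrow> 'a set \<Rightarrow> bool" where
  "is_parent \<Q> Q P \<longleftrightarrow> P \<in> cells \<Q> \<and> Q \<subset> P \<and> \<not> (\<exists>R\<in>cells \<Q>. Q \<subset> R \<and> R \<subset> P)"

definition children :: "(int \<Rightarrow> 'a set set) \<Rightarrow> 'a set \<Rightarrow> 'a set set" where
  "children \<Q> P = {Q \<in> cells \<Q>. is_parent \<Q> Q P}"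

text \<open>A cell may have infinitely many children; they are disjoint, so at each point the following
  infinite sum has at most one nonzero term.\<close>

definition mart_diff ::
  "'a measure \<Rightarrow> (int \<Rightarrow> 'a set set) \<Rightarrow> 'a set \<Rightarrow> ('a \<Rightarrow> complex) \<Rightarrow> 'a \<Rightarrow> complex" where
  "mart_diff M \<Q> P f x =
     (\<Sum>\<^sub>\<infinity>Q\<in>children \<Q> P. indicator Q x * (average M f Q - average M f P))"

text \<open>Scalars are complex; real functions and real multipliers are a special case. The cells
  containing \<open>x\<close> that occur at some level from \<open>m\<close> to \<open>n\<close> form an interval of the chain of all cells
  containing \<open>x\<close>; a cell that occurs at several levels is counted once. The chain may be infinite in
  both directions, so the limit is taken as \<open>m\<close> tends to minus infinity and, independently, \<open>n\<close>
  tends to infinity.\<close>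

definition transform_partial_sum ::
  "'a measure \<Rightarrow> (int \<Rightarrow> 'a set set) \<Rightarrow> ('a set \<Rightarrow> complex) \<Rightarrow> ('a \<Rightarrow> complex) \<Rightarrow> 'a \<Rightarrow> int \<times> int \<Rightarrow> complex"
  where
  "transform_partial_sum M \<Q> \<epsilon> f x =
     (\<lambda>(m, n). \<Sum>P | P \<in> (\<Union>k\<in>{m..n}. \<Q> k) \<and> x \<in> P. \<epsilon> P * mart_diff M \<Q> P f x)"

definition transform_converges ::
  "'a measure \<Rightarrow> (int \<Rightarrow> 'a set set) \<Rightarrow> ('a set \<Rightarrow> complex) \<Rightarrow> ('a \<Rightarrow> complex) \<Rightarrow> 'a \<Rightarrow> bool" where
  "transform_converges M \<Q> \<epsilon> f x \<longleftrightarrow>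
     (\<exists>l. (transform_partial_sum M \<Q> \<epsilon> f x \<longlongrightarrow> l) (at_bot \<times>\<^sub>F at_top))"

definition mart_transform ::
  "'a measure \<Rightarrow> (int \<Rightarrow> 'a set set) \<Rightarrow> ('a set \<Rightarrow> complex) \<Rightarrow> ('a \<Rightarrow> complex) \<Rightarrow> 'a \<Rightarrow> complex" where
  "mart_transform M \<Q> \<epsilon> f x = Lim (at_bot \<times>\<^sub>F at_top) (transform_partial_sum M \<Q> \<epsilon> f x)"

text \<open>For integrable \<open>f\<close> the inner sum converges absolutely at every point, because the cells
  containing a given \<open>Q'\<close> have measure bounded below; so its order does not matter.\<close>

definition max_truncation ::
  "'a measure \<Rightarrow> (int \<Rightarrow> 'a set set) \<Rightarrow> ('a set \<Rightarrow> complex) \<Rightarrow> ('a \<Rightarrow> complex) \<Rightarrow> 'a \<Rightarrow> ennreal" where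
  "max_truncation M \<Q> \<epsilon> f x =
     (SUP Q'\<in>cells \<Q>. ennreal (norm
        (\<Sum>\<^sub>\<infinity>Q\<in>{Q \<in> cells \<Q>. Q' \<subseteq> Q}. \<epsilon> Q * mart_diff M \<Q> Q f x)))"

definition stopping_children :: "'a set set \<Rightarrow> 'a set \<Rightarrow> 'a set set" where
  "stopping_children \<S> P = {Q \<in> \<S>. Q \<subset> P \<and> \<not> (\<exists>R\<in>\<S>. Q \<subset> R \<and> R \<subset> P)}"

definition sparse_family :: "'a measure \<Rightarrow> (int \<Rightarrow> 'a set set) \<Rightarrow> 'a set set \<Rightarrow> bool" where
  "sparse_family M \<Q> \<S> \<longleftrightarrow> \<S> \<subseteq> cells \<Q> \<and>
     (\<forall>P\<in>\<S>. (\<Sum>\<^sub>\<infinity>Q\<in>stopping_children \<S> P. emeasure M Q) \<le> emeasure M P / 2)"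

text \<open>For nonnegative \<open>g\<close> only. The sum is taken in \<^typ>\<open>ennreal\<close>, so that it is defined at every
  point; the coercion would discard negative averages.\<close>

definition sparse_operator :: "'a measure \<Rightarrow> 'a set set \<Rightarrow> ('a \<Rightarrow> real) \<Rightarrow> 'a \<Rightarrow> ennreal" where
  "sparse_operator M \<S> g x = (\<Sum>\<^sub>\<infinity>P\<in>\<S>. ennreal (average M g P) * indicator P x)"

end

theory Submission imports Defs begin

text \<open>
  For a cell \<open>R\<close> the transform is written as a sum over levels, from the level of \<open>R\<close> downwards. Burkholder's
  function turns the pair (average of \<open>f\<close>, partial sum) into a supermartingale, which gives the weak type
  \<open>(1,1)\<close> bound for the maximal partial sum without any assumption on the branching. Hence the cells below
  \<open>P\<close> at which the average of \<open>|f|\<close> or the partial sum started at \<open>P\<close> first exceeds six times the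
  average of \<open>|f|\<close> over \<open>P\<close> cover at most half of \<open>P\<close>. Restarting at these cells produces a sparse
  family; between two consecutive stopping cells the partial sums change by at most a constant times the
  corresponding averages. Above \<open>Q\<^sub>0\<close> the average is \<open>\<integral>f\<close> divided by the measure of the cell, so the
  differences telescope. Almost everywhere convergence follows from the weak type bound and the
  density in \<open>L\<^sup>1(Q\<^sub>0)\<close> of the functions that are constant on the cells of some level.
\<close>

subsection \<open>Countable partitions and Burkholder's function\<close>

text \<open>With unbounded branching the average over a cell gives no control of the averages over
  its children, so the jump into a stopping cell is not comparable to the averages above it. It is
  charged to the average over the stopping cell itself, which the sparse operator contains.
  Burkholder's function fits this setting because it uses only that the differences of averages have
  mean zero over a cell and that the multipliers are at most 1 in norm.

  Six is twice the weak type constant 3, so that at most half of \<open>P\<close> is bad; of the 3,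
  two come from Burkholder's function and one pays for stopping on averages as well. Between
  consecutive stops the sum changes by at most 6 + 6 averages over the old cell plus one over the
  new cell, so each stopping cell is charged 13 averages. One more average over
  \<open>Q\<^sub>0\<close> pays for all larger cells, whence the constant 14.

  A cell may persist through several levels. Sums over levels do not notice this, as repeated cells
  contribute zero, but sums over cells must count it once; much of the bookkeeping reconciles the
  two.\<close>

lemma has_sum_set_integral:
  fixes f :: "'a \<Rightarrow> 'b::{banach, second_countable_topology}"
  assumes C: "countable C" "C \<subseteq> sets M" "disjoint C" and f: "integrable M f"
  shows "((\<lambda>A. LINT x:A|M. f x) has_sum (LINT x:\<Union>C|M. f x)) C"
proof -
  \<comment> \<open>Padding with empty sets turns a finite or infinite \<open>C\<close> into one
    disjoint sequence, to which countable additivity of the integral applies.\<close>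
  define A where "A i = (if i \<in> to_nat_on C ` C then from_nat_into C i else {})" for i :: nat
  have A_sets: "A i \<in> sets M" for i
    using C(1,2) by (auto simp: A_def)
  have inj: "inj_on (to_nat_on C) C"
    using C(1) by (rule inj_on_to_nat_on)
  have A_to: "A (to_nat_on C Q) = Q" if "Q \<in> C" for Q
    using that C(1) by (simp add: A_def)
  have A_disj: "A i \<inter> A j = {}" if "i \<noteq> j" for i j
  proof (cases "i \<in> to_nat_on C ` C \<and> j \<in> to_nat_on C ` C")
    case True
    then obtain P Q where "P \<in> C" "Q \<in> C" "i = to_nat_on C P" "j = to_nat_on C Q"
      by blast
    then show ?thesis
      using that disjointD[OF C(3), of P Q] A_to by (cases "P = Q") simp_all
  qed (auto simp: A_def)
  have UA: "(\<Union>i. A i) = \<Union>C"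
  proof
    show "(\<Union>i. A i) \<subseteq> \<Union>C"
      using C(1) by (auto simp: A_def split: if_splits)
    show "\<Union>C \<subseteq> (\<Union>i. A i)"
      using A_to by blast
  qed
  have set_int: "set_integrable M B g" if "integrable M g" "B \<in> sets M"
    for B and g :: "'a \<Rightarrow> 'c::{banach, second_countable_topology}"
    using that by (simp add: set_integrable_def integrable_mult_indicator)
  have "summable (\<lambda>i. norm (LINT x:A i|M. f x))"
  proof (rule summable_comparison_test)
    show "\<exists>N. \<forall>n\<ge>N. norm (norm (LINT x:A n|M. f x)) \<le> (LINT x:A n|M. norm (f x))"
      using set_integral_norm_bound[OF set_int[OF f A_sets]] by auto
    show "summable (\<lambda>n. LINT x:A n|M. norm (f x))"
    proof (rule summableI_nonneg_bounded)
      show "0 \<le> (LINT x:A n|M. norm (f x))" for n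
        by (auto simp: set_lebesgue_integral_def intro!: integral_nonneg_AE)
      have "(\<Sum>i<n. LINT x:A i|M. norm (f x)) = (LINT x|M. (\<Sum>i<n. indicator (A i) x *\<^sub>R norm (f x)))" for n
        using set_int[OF integrable_norm[OF f] A_sets]
        by (subst Bochner_Integration.integral_sum) (auto simp: set_lebesgue_integral_def set_integrable_def)
      also have "\<dots> n \<le> (LINT x|M. norm (f x))" for n
      proof (rule integral_mono)
        show "integrable M (\<lambda>x. \<Sum>i<n. indicator (A i) x *\<^sub>R norm (f x))"
          using set_int[OF integrable_norm[OF f] A_sets]
          unfolding set_integrable_def by (rule Bochner_Integration.integrable_sum)
        show "integrable M (\<lambda>x. norm (f x))" using f by auto
        have "(\<Sum>i<n. indicator (A i) x :: real) = indicator (\<Union>i<n. A i) x" for x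
          using A_disj by (intro indicator_UN_disjoint[symmetric]) (auto simp: disjoint_family_on_def)
        then show "(\<Sum>i<n. indicator (A i) x *\<^sub>R norm (f x)) \<le> norm (f x)" for x
          by (simp flip: sum_distrib_right) (simp add: indicator_def)
      qed
      finally show "(\<Sum>i<n. LINT x:A i|M. norm (f x)) \<le> (LINT x|M. norm (f x))" for n .
    qed
  qed
  moreover have "(\<Sum>i. LINT x:A i|M. f x) = (LINT x:\<Union>C|M. f x)"
    using lebesgue_integral_countable_add[of A M f] A_sets A_disj UA set_int[OF f, of "\<Union>C"] C
    by (simp add: sets.countable_Union)
  ultimately have "((\<lambda>i. LINT x:A i|M. f x) has_sum (LINT x:\<Union>C|M. f x)) UNIV"
    using norm_summable_imp_has_sum[OF _ summable_sums[OF summable_norm_cancel]] by fastforce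
  then have "((\<lambda>i. LINT x:A i|M. f x) has_sum (LINT x:\<Union>C|M. f x)) (to_nat_on C ` C)"
    by (subst has_sum_cong_neutral[where T = UNIV and g = "\<lambda>i. LINT x:A i|M. f x"])
       (auto simp: A_def set_lebesgue_integral_def)
  then have "((\<lambda>Q. LINT x:A (to_nat_on C Q)|M. f x) has_sum (LINT x:\<Union>C|M. f x)) C"
    by (simp add: has_sum_reindex[OF inj] o_def)
  then show ?thesis
    by (rule has_sum_cong[THEN iffD1, rotated]) (simp add: A_to)
qed

text \<open>Finite sums of the measures stay below \<open>measure M R\<close>, and a summable family
  has only countably many nonzero members. This keeps the sums over subcells countable although the
  branching is unbounded.\<close>

lemma countable_disjoint_subsets:
  assumes "disjoint C" "C \<subseteq> sets M" "R \<in> sets M" "emeasure M R < \<infinity>"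
    and "\<And>Q. Q \<in> C \<Longrightarrow> Q \<subseteq> R \<and> 0 < emeasure M Q"
  shows "countable C"
proof -
  have fin: "emeasure M Q \<noteq> \<infinity>" if "Q \<in> C" for Q
    using emeasure_mono[of Q R M] assms that by (auto simp: top_unique)
  have "(\<lambda>Q. norm (measure M Q)) summable_on C"
  proof (rule nonneg_bounded_partial_sums_imp_summable_on[where C = "measure M R"])
    show "eventually (\<lambda>F. sum (\<lambda>Q. norm (measure M Q)) F \<le> measure M R) (finite_subsets_at_top C)"
    proof (rule eventually_finite_subsets_at_top_weakI)
      fix F assume F: "finite F" "F \<subseteq> C"
      have "pairwise (\<lambda>P Q. disjnt P Q) F"
        using pairwise_subset[OF assms(1) F(2)] .
      moreover have "Q \<in> fmeasurable M" if "Q \<in> F" for Q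
        using that F fin assms(2) by (metis fmeasurableI infinity_ennreal_def subsetD top.not_eq_extremum)
      ultimately have "(\<Sum>Q\<in>F. measure M Q) = measure M (\<Union>Q\<in>F. Q)"
        using F(1) by (intro measure_UNION'[symmetric])
      also have "\<dots> \<le> measure M R"
        using F assms by (intro measure_mono_fmeasurable) (auto simp: fmeasurable_def)
      finally show "sum (\<lambda>Q. norm (measure M Q)) F \<le> measure M R" by simp
    qed
  qed auto
  then have "countable {Q\<in>C. measure M Q \<noteq> 0}"
    by (rule abs_summable_countable)
  moreover have "measure M Q \<noteq> 0" if "Q \<in> C" for Q
    using assms(5)[OF that] fin[OF that] emeasure_eq_ennreal_measure[of M Q] by (metis ennreal_0 infinity_ennreal_def less_irrefl)
  ultimately show ?thesis
    by (elim countable_subset[rotated]) blast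
qed

text \<open>Burkholder's special function for the weak type inequality: \<open>x\<close> is the
  value of the martingale, \<open>y\<close> that of its transform. For \<open>norm x \<le> 1\<close>
  it is the smaller of the two expressions, which differ by
  \<open>(norm y)\<^sup>2 - (1 - norm x)\<^sup>2\<close>.\<close>

definition burkholder :: "'b::real_inner \<Rightarrow> 'b \<Rightarrow> real" where
  "burkholder x y = (if norm x + norm y \<le> 1 then (norm y)\<^sup>2 - (norm x)\<^sup>2 else 1 - 2 * norm x)"

lemma burkholder_le: "burkholder x y \<le> 1 - 2 * norm x"
proof (cases "norm x + norm y \<le> 1")
  case True
  then have "(norm y)\<^sup>2 \<le> (1 - norm x)\<^sup>2"
    by (intro power_mono) auto
  then show ?thesis
    using True by (simp add: burkholder_def power2_diff)
qed (simp add: burkholder_def)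

lemma burkholder_le_diff:
  assumes "norm x \<le> 1"
  shows "burkholder x y \<le> (norm y)\<^sup>2 - (norm x)\<^sup>2"
proof (cases "norm x + norm y \<le> 1")
  case False
  then have "(1 - norm x)\<^sup>2 \<le> (norm y)\<^sup>2"
    using assms by (intro power_mono) auto
  then show ?thesis
    using False by (simp add: burkholder_def power2_diff)
qed (simp add: burkholder_def)

lemma burkholder_ge: "- 2 * norm x \<le> burkholder x y"
proof (cases "norm x + norm y \<le> 1")
  case True
  then have "norm x \<le> 1"
    using norm_ge_zero[of y] by linarith
  then have "norm x * norm x \<le> norm x"
    by (simp add: mult_left_le)
  moreover have "0 \<le> norm y * norm y" "0 \<le> norm x"
    by simp_all
  ultimately have "- 2 * norm x \<le> norm y * norm y - norm x * norm x"
    by linarith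
  then show ?thesis
    using True by (simp add: burkholder_def power2_eq_square)
qed (simp add: burkholder_def)

text \<open>Together with \<open>burkholder_ge\<close>: the function majorizes the indicator of
  \<open>1 \<le> norm y\<close> minus \<open>2 * norm x\<close>, which turns an upper bound for its
  mean into a weak type estimate.\<close>

lemma burkholder_ge_1:
  assumes "1 \<le> norm y"
  shows "1 - 2 * norm x \<le> burkholder x y"
proof (cases "norm x + norm y \<le> 1")
  case True
  then have "norm x = 0" "norm y = 1"
    using assms norm_ge_zero[of x] by linarith+
  then show ?thesis
    by (simp add: burkholder_def)
qed (simp add: burkholder_def)

lemma burkholder_0_nonpos: "burkholder x 0 \<le> 0"
  by (simp add: burkholder_def)

text \<open>Concavity in the directions \<open>(h, e * h)\<close>, as an affine majorant that
  touches at \<open>h = 0\<close>. Its linear part averages to zero over the subcells of a cell, so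
  this is the supermartingale property.\<close>

lemma burkholder_step:
  fixes x y :: complex and e :: complex
  assumes e: "norm e \<le> 1"
  obtains l :: "complex \<Rightarrow> real" where "bounded_linear l"
    "\<And>h. burkholder (x + h) (y + e * h) \<le> burkholder x y + l h"
proof (cases "norm x + norm y \<le> 1")
  case False
  \<comment> \<open>In this region the function is the concave \<open>1 - 2 * norm x\<close>, and
    \<open>sgn x\<close> gives a supporting functional, also at the kink because
    \<open>sgn 0 = 0\<close>.\<close>
  have "burkholder (x + h) (y + e * h) \<le> burkholder x y + - 2 * (sgn x \<bullet> h)" for h
  proof -
    have "norm x + sgn x \<bullet> h = sgn x \<bullet> (x + h)"
      by (cases "x = 0") (simp_all add: inner_add_right sgn_div_norm power2_norm_eq_inner[symmetric] power2_eq_square)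
    also have "\<dots> \<le> norm (sgn x) * norm (x + h)"
      by (rule norm_cauchy_schwarz)
    also have "\<dots> \<le> norm (x + h)"
      by (simp add: norm_sgn)
    finally show ?thesis
      using False burkholder_le[of "x + h" "y + e * h"] by (simp add: burkholder_def)
  qed
  moreover have "bounded_linear (\<lambda>h. - 2 * (sgn x \<bullet> h))"
    by (intro bounded_linear_intros)
  ultimately show ?thesis
    using that by blast
next
  case True
  \<comment> \<open>The linear part is the derivative of
    \<open>(norm y)\<^sup>2 - (norm x)\<^sup>2\<close>; the quadratic remainder
    \<open>(norm k)\<^sup>2 - (norm h)\<^sup>2\<close> is nonpositive since
    \<open>norm e \<le> 1\<close>.\<close>
  have "burkholder (x + h) (y + e * h) \<le> burkholder x y + (2 * (y \<bullet> (e * h)) - 2 * (x \<bullet> h))" for h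
  proof -
    define k where "k = e * h"
    have k: "norm k \<le> norm h"
      using e by (simp add: k_def norm_mult mult_left_le_one_le)
    have yk: "(norm (y + k))\<^sup>2 = (norm y)\<^sup>2 + 2 * (y \<bullet> k) + (norm k)\<^sup>2"
      by (simp add: power2_norm_eq_inner inner_add_left inner_add_right inner_commute)
    have xh: "(norm (x + h))\<^sup>2 = (norm x)\<^sup>2 + 2 * (x \<bullet> h) + (norm h)\<^sup>2"
      by (simp add: power2_norm_eq_inner inner_add_left inner_add_right inner_commute)
    have bxy: "burkholder x y = (norm y)\<^sup>2 - (norm x)\<^sup>2"
      using True by (simp add: burkholder_def)
    have k2: "(norm k)\<^sup>2 \<le> (norm h)\<^sup>2"
      using k by simp
    show ?thesis
    proof (cases "norm (x + h) \<le> 1")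
      case le: True
      show ?thesis
        using burkholder_le_diff[OF le, of "y + k"] yk xh k2 bxy
        unfolding k_def by linarith
    next
      case False
      \<comment> \<open>As \<open>x + h\<close> has left the unit ball, only the bound
        \<open>1 - 2 * norm (x + h)\<close> is available; comparing it with the quadratic expansion
        amounts to estimating this square.\<close>
      have "(norm (x + h) - 1)\<^sup>2 \<le> (norm h - norm y)\<^sup>2"
        using False True norm_triangle_ineq[of x h] by (intro power_mono) auto
      also have "\<dots> = (norm h)\<^sup>2 - 2 * norm h * norm y + (norm y)\<^sup>2"
        by (simp add: power2_diff)
      also have "\<dots> \<le> (norm h)\<^sup>2 + 2 * (y \<bullet> k) + (norm y)\<^sup>2"
      proof -
        have "\<bar>y \<bullet> k\<bar> \<le> norm y * norm k"
          by (rule Cauchy_Schwarz_ineq2)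
        also have "\<dots> \<le> norm y * norm h"
          using k by (simp add: mult_left_mono)
        finally show ?thesis by (simp add: mult.commute)
      qed
      finally show ?thesis
        using burkholder_le[of "x + h" "y + k"] xh bxy
        unfolding k_def power2_diff by simp
    qed
  qed
  moreover have "bounded_linear (\<lambda>h. 2 * (y \<bullet> (e * h)) - 2 * (x \<bullet> h))"
    by (intro bounded_linear_intros)
  ultimately show ?thesis
    using that by blast
qed

context partition_filtration
begin

subsection \<open>Cells and averages\<close>

lemma space_cells: "\<Union>(\<Q> n) = space M"
  using partition_onD1[OF partition_cells[of n]] by simp

lemma disjoint_cells: "disjoint (\<Q> n)"
  using partition_onD2[OF partition_cells[of n]] .

lemma cells_same_level: "P \<in> \<Q> n \<Longrightarrow> Q \<in> \<Q> n \<Longrightarrow> x \<in> P \<Longrightarrow> x \<in> Q \<Longrightarrow> P = Q"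
  using disjointD[OF disjoint_cells[of n], of P Q] by blast

definition cell :: "int \<Rightarrow> 'a \<Rightarrow> 'a set" where
  "cell n x = (THE Q. Q \<in> \<Q> n \<and> x \<in> Q)"

lemma cell_eq: "Q \<in> \<Q> n \<Longrightarrow> x \<in> Q \<Longrightarrow> cell n x = Q"
  unfolding cell_def by (rule the_equality) (simp, metis cells_same_level)

lemma cell: assumes "x \<in> space M" shows "cell n x \<in> \<Q> n" "x \<in> cell n x"
proof -
  obtain Q where "Q \<in> \<Q> n" "x \<in> Q"
    using assms space_cells[of n] by blast
  then show "cell n x \<in> \<Q> n" "x \<in> cell n x"
    by (simp_all add: cell_eq)
qed

lemma cells_sets: "Q \<in> \<Q> n \<Longrightarrow> Q \<in> sets M"
  using measurable_cells by blast

lemma cellsI: "Q \<in> \<Q> n \<Longrightarrow> Q \<in> cells \<Q>"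
  by (auto simp: cells_def)

lemma cells_space: "Q \<in> \<Q> n \<Longrightarrow> Q \<subseteq> space M"
  by (simp add: cells_sets sets.sets_into_space)

lemma cell_cong: "x \<in> space M \<Longrightarrow> y \<in> cell n x \<Longrightarrow> cell n y = cell n x"
  by (simp add: cell(1) cell_eq)

lemma cell_Suc_subset:
  assumes "x \<in> space M" shows "cell (n + 1) x \<subseteq> cell n x"
proof -
  obtain A where A: "A \<subseteq> \<Q> (n + 1)" "cell n x = \<Union>A"
    using refine_cells[OF cell(1)[OF assms, of n]] by (elim exE conjE) (rule that)
  have "x \<in> \<Union>A"
    using cell(2)[OF assms, of n] unfolding A(2) .
  then obtain Q where Q: "Q \<in> A" "x \<in> Q"
    by (rule UnionE)
  then have "cell (n + 1) x = Q"
    using A(1) by (intro cell_eq) auto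
  then show ?thesis
    using A(2) Q(1) by auto
qed

lemma cell_antimono:
  assumes "x \<in> space M" "m \<le> n" shows "cell n x \<subseteq> cell m x"
  using assms(2)
proof (induction n rule: int_ge_induct)
  case (step i)
  then show ?case
    using cell_Suc_subset[OF assms(1), of i] by blast
qed simp

lemma cell_cong_le:
  assumes "x \<in> space M" "y \<in> cell n x" "m \<le> n" shows "cell m y = cell m x"
  using cell_antimono[OF assms(1,3)] assms(2) by (intro cell_cong[OF assms(1)]) auto

lemma cells_emeasure: "Q \<in> \<Q> n \<Longrightarrow> emeasure M Q = ennreal (measure M Q)"
  using emeasure_cells[of Q n] by (simp add: emeasure_eq_ennreal_measure less_top)

lemma measure_cells_pos: "Q \<in> \<Q> n \<Longrightarrow> 0 < measure M Q"
  using emeasure_cells[of Q n] cells_emeasure[of Q n] by simp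

section \<open>Cells of one level inside a fixed cell\<close>

definition subcells :: "int \<Rightarrow> 'a set \<Rightarrow> 'a set set" where
  "subcells n R = {Q \<in> \<Q> n. Q \<subseteq> R}"

lemma subcells_Union:
  assumes R: "R \<in> \<Q> k" and "k \<le> n"
  shows "\<Union>(subcells n R) = R"
proof
  show "R \<subseteq> \<Union>(subcells n R)"
  proof
    fix x assume x: "x \<in> R"
    then have xs: "x \<in> space M"
      using cells_space[OF R] by blast
    then have "cell n x \<subseteq> R"
      using cell_antimono[OF xs \<open>k \<le> n\<close>] cell_eq[OF R x] by simp
    then show "x \<in> \<Union>(subcells n R)"
      using cell[OF xs, of n] by (auto simp: subcells_def)
  qed
qed (auto simp: subcells_def)

lemma subcells_countable:
  assumes R: "R \<in> \<Q> k"
  shows "countable (subcells n R)"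
proof (rule countable_disjoint_subsets)
  show "disjoint (subcells n R)"
    using disjoint_cells[of n] by (rule pairwise_subset) (auto simp: subcells_def)
  show "subcells n R \<subseteq> sets M" "R \<in> sets M" "emeasure M R < \<infinity>"
    using cells_sets emeasure_cells R by (auto simp: subcells_def)
qed (use emeasure_cells in \<open>auto simp: subcells_def\<close>)

lemma subcells_has_sum:
  fixes f :: "'a \<Rightarrow> 'b::{banach, second_countable_topology}"
  assumes R: "R \<in> \<Q> k" and "k \<le> n" and f: "integrable M f"
  shows "((\<lambda>Q. LINT x:Q|M. f x) has_sum (LINT x:R|M. f x)) (subcells n R)"
proof -
  have "disjoint (subcells n R)"
    using disjoint_cells[of n] by (rule pairwise_subset) (auto simp: subcells_def)
  moreover have "subcells n R \<subseteq> sets M"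
    using cells_sets by (auto simp: subcells_def)
  ultimately show ?thesis
    using has_sum_set_integral[OF subcells_countable[OF R], of n M f] f subcells_Union[OF R \<open>k \<le> n\<close>]
    by simp
qed

lemma subcells_has_sum_measure:
  assumes R: "R \<in> \<Q> k" and "k \<le> n" and A: "A \<in> sets M" "A \<subseteq> R"
  shows "((\<lambda>Q. measure M (A \<inter> Q)) has_sum measure M A) (subcells n R)"
proof -
  have fin: "emeasure M A < \<infinity>"
    using emeasure_mono[OF A(2) cells_sets[OF R]] emeasure_cells[OF R] by (meson order_le_less_trans)
  have int: "(LINT x:Q|M. indicator A x :: real) = measure M (A \<inter> Q)" if "Q \<in> sets M" for Q
  proof -
    have "(LINT x:Q|M. indicator A x :: real) = (LINT x|M. indicator (A \<inter> Q) x)"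
      unfolding set_lebesgue_integral_def
      by (rule Bochner_Integration.integral_cong) (auto simp: indicator_def)
    then show ?thesis
      using that A(1) sets.sets_into_space[OF that] by (simp add: Int_absorb2 Int_assoc)
  qed
  have "((\<lambda>Q. LINT x:Q|M. indicator A x :: real) has_sum (LINT x:R|M. indicator A x)) (subcells n R)"
    using A fin by (intro subcells_has_sum[OF R \<open>k \<le> n\<close>]) (simp add: integrable_indicator_iff Int_absorb2 sets.sets_into_space)
  then show ?thesis
    using int[OF cells_sets[OF R]] A(2) cells_sets
    by (subst (asm) has_sum_cong[of _ _ "\<lambda>Q. measure M (A \<inter> Q)"]) (auto simp: int subcells_def Int_absorb2)
qed

text \<open>The transform restricted to the levels from \<open>m\<close> up to, but excluding,
  \<open>n\<close>. A level at which the cell of \<open>x\<close> does not change contributes zero,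
  so parents and children need not be mentioned.\<close>

definition psum :: "('a set \<Rightarrow> complex) \<Rightarrow> ('a \<Rightarrow> complex) \<Rightarrow> int \<Rightarrow> int \<Rightarrow> 'a \<Rightarrow> complex" where
  "psum \<epsilon> f m n x =
     (\<Sum>k\<in>{m..<n}. \<epsilon> (cell k x) * (average M f (cell (k + 1) x) - average M f (cell k x)))"

lemma psum_empty: "n \<le> m \<Longrightarrow> psum \<epsilon> f m n x = 0"
  by (simp add: psum_def)

lemma psum_add: "k \<le> m \<Longrightarrow> m \<le> n \<Longrightarrow> psum \<epsilon> f k n x = psum \<epsilon> f k m x + psum \<epsilon> f m n x"
  unfolding psum_def by (subst sum.union_disjoint[symmetric]) (auto simp: ivl_disj_un)

lemma psum_step: "psum \<epsilon> f m (m + 1) x = \<epsilon> (cell m x) * (average M f (cell (m + 1) x) - average M f (cell m x))"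
proof -
  have "{m..<m + 1} = {m}" by auto
  then show ?thesis by (simp add: psum_def)
qed

lemma psum_cong:
  assumes "x \<in> space M" "y \<in> cell n x"
  shows "psum \<epsilon> f m n y = psum \<epsilon> f m n x"
  unfolding psum_def using cell_cong_le[OF assms] by (intro sum.cong) auto

lemma set_integrable_cells:
  fixes f :: "'a \<Rightarrow> 'b::{banach, second_countable_topology}"
  shows "integrable M f \<Longrightarrow> Q \<in> \<Q> n \<Longrightarrow> set_integrable M Q f"
  by (simp add: set_integrable_def cells_sets integrable_mult_indicator)

lemma average_scaleR:
  fixes f :: "'a \<Rightarrow> 'b::{banach, second_countable_topology}"
  shows "average M (\<lambda>x. c *\<^sub>R f x) Q = c *\<^sub>R average M f Q"
  by (simp add: average_def set_lebesgue_integral_def scaleR_left_commute[of _ c])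

lemma measure_average:
  fixes f :: "'a \<Rightarrow> 'b::{banach, second_countable_topology}"
  shows "Q \<in> \<Q> n \<Longrightarrow> measure M Q *\<^sub>R average M f Q = (LINT x:Q|M. f x)"
  using measure_cells_pos[of Q n] by (simp add: average_def)

lemma average_norm_nonneg: "0 \<le> average M (\<lambda>x. norm (f x)) Q"
  by (auto simp: average_def set_lebesgue_integral_def intro!: mult_nonneg_nonneg integral_nonneg_AE)

lemma norm_average_le:
  fixes f :: "'a \<Rightarrow> 'b::{banach, second_countable_topology}"
  assumes "integrable M f" "Q \<in> \<Q> n"
  shows "norm (average M f Q) \<le> average M (\<lambda>x. norm (f x)) Q"
  using set_integral_norm_bound[OF set_integrable_cells[OF assms]]
  by (simp add: average_def divide_right_mono)

text \<open>Induction on the number \<open>j\<close> of levels examined below \<open>R\<close>. The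
  start \<open>s\<close> is arbitrary because it absorbs one summand when passing to a cell of the
  next level. Of the three integrals of \<open>norm (f x)\<close>, two compensate the lower bound
  \<open>- 2 * norm x\<close> of Burkholder's function and one pays for points where only the
  average is large.\<close>

lemma burkholder_weak_type:
  assumes f: "integrable M f" and \<epsilon>: "\<forall>P\<in>cells \<Q>. norm (\<epsilon> P) \<le> 1"
    and R: "R \<in> \<Q> k"
  defines "E \<equiv> \<lambda>j k R s. {x \<in> R. \<exists>i\<le>j. 1 \<le> norm (s + psum \<epsilon> f k (k + int i) x)
        \<or> 1 \<le> average M (\<lambda>y. norm (f y)) (cell (k + int i) x)}"
  shows "E j k R s \<in> sets M \<and>
    measure M (E j k R s) \<le> 3 * (LINT x:R|M. norm (f x)) + measure M R * burkholder (average M f R) s"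
  using R
proof (induction j arbitrary: k R s)
  let ?F = "\<lambda>R. LINT x:R|M. norm (f x)"
  let ?a = "\<lambda>R. average M (\<lambda>y. norm (f y)) R"
  let ?c = "average M f"
  have F: "measure M R * ?a R = ?F R" if "R \<in> \<Q> k" for R k
    using measure_average[OF that, of "\<lambda>y. norm (f y)"] by simp
  have bad: "measure M R \<le> 3 * ?F R + measure M R * burkholder (?c R) s"
    if R: "R \<in> \<Q> k" and "1 \<le> norm s \<or> 1 \<le> ?a R" for k R s
  proof -
    have c: "norm (?c R) \<le> ?a R"
      using norm_average_le[OF f R] .
    have "1 \<le> 3 * ?a R + burkholder (?c R) s"
      using that(2)
    proof
      assume "1 \<le> norm s"
      then show ?thesis
        using c burkholder_ge_1[of s "?c R"] norm_ge_zero[of "?c R"] by linarith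
    next
      assume "1 \<le> ?a R"
      then show ?thesis
        using c burkholder_ge[of "?c R" s] by linarith
    qed
    then have "measure M R * 1 \<le> measure M R * (3 * ?a R + burkholder (?c R) s)"
      by (rule mult_left_mono) simp
    then show ?thesis
      by (simp add: distrib_left mult.left_commute[of _ 3] F[OF R])
  qed
  have nonneg: "0 \<le> 3 * ?F R + measure M R * burkholder (?c R) s" if R: "R \<in> \<Q> k" for k R s
  proof -
    have "0 \<le> 3 * ?a R + burkholder (?c R) s"
      using norm_average_le[OF f R] burkholder_ge[of "?c R" s] norm_ge_zero[of "?c R"] by linarith
    then have "0 \<le> measure M R * (3 * ?a R + burkholder (?c R) s)"
      by simp
    then show ?thesis
      by (simp add: distrib_left mult.left_commute[of _ 3] F[OF R])
  qed
  {
    case (0 k R s)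
    have "E 0 k R s = (if 1 \<le> norm s \<or> 1 \<le> ?a R then R else {})"
      using cell_eq[OF 0] by (auto simp: E_def psum_empty)
    then show ?case
      using bad[OF 0, of s] nonneg[OF 0, of s] cells_sets[OF 0] by simp
  next
    case (Suc j k R s)
    note R = Suc.prems
    show ?case
    proof (cases "1 \<le> norm s \<or> 1 \<le> ?a R")
      case True
      then have "E (Suc j) k R s = R"
        using cell_eq[OF R] by (auto simp: E_def psum_empty intro!: exI[of _ 0])
      then show ?thesis
        using bad[OF R, of s] True cells_sets[OF R] by simp
    next
      case False
      define t where "t Q = s + \<epsilon> R * (?c Q - ?c R)" for Q
      define S where "S = subcells (k + 1) R"
      have S: "Q \<in> \<Q> (k + 1)" "Q \<subseteq> R" if "Q \<in> S" for Q
        using that by (auto simp: S_def subcells_def)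
      \<comment> \<open>As the level of \<open>R\<close> itself is not exceptional, the exceptional
        set inside \<open>Q\<close> is that of the problem started at \<open>Q\<close> with the
        value \<open>t Q\<close>.\<close>
      have EQ: "E (Suc j) k R s \<inter> Q = E j (k + 1) Q (t Q)" if Q: "Q \<in> S" for Q
      proof -
        have "x \<in> E (Suc j) k R s \<longleftrightarrow> x \<in> E j (k + 1) Q (t Q)" if x: "x \<in> Q" for x
        proof -
          have c: "cell k x = R" "cell (k + 1) x = Q"
            using cell_eq[OF R] cell_eq[OF S(1)[OF Q] x] S(2)[OF Q] x by auto
          have p: "s + psum \<epsilon> f k (k + (1 + int i)) x = t Q + psum \<epsilon> f (k + 1) (k + (1 + int i)) x" for i
            using psum_add[of k "k + 1" "k + (1 + int i)" \<epsilon> f x] by (simp add: psum_step c t_def)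
          have "(\<exists>i\<le>Suc j. P i) \<longleftrightarrow> P 0 \<or> (\<exists>i\<le>j. P (Suc i))" for P
            by (metis le0 not0_implies_Suc Suc_le_mono)
          then show ?thesis
            using False x S(2)[OF Q] c by (auto simp: E_def psum_empty p add.assoc)
        qed
        then show ?thesis by (auto simp: E_def)
      qed
      have E_eq: "E (Suc j) k R s = (\<Union>Q\<in>S. E j (k + 1) Q (t Q))"
      proof -
        have "E (Suc j) k R s = (\<Union>Q\<in>S. E (Suc j) k R s \<inter> Q)"
          using subcells_Union[OF R, of "k + 1"] by (auto simp: E_def S_def)
        then show ?thesis using EQ by simp
      qed
      have E_sets: "E (Suc j) k R s \<in> sets M"
        unfolding E_eq using Suc.IH S(1) subcells_countable[OF R] by (intro sets.countable_UN') (auto simp: S_def)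
      obtain l where l: "bounded_linear l"
        "\<And>h. burkholder (?c R + h) (s + \<epsilon> R * h) \<le> burkholder (?c R) s + l h"
        using burkholder_step[OF bspec[OF \<epsilon> cellsI[OF R]]] by metis
      interpret l: bounded_linear l by (rule l)
      have IH: "measure M (E (Suc j) k R s \<inter> Q) \<le> 3 * ?F Q + (measure M (R \<inter> Q) * burkholder (?c R) s
          + (l (LINT x:Q|M. f x) + measure M (R \<inter> Q) * - l (?c R)))" if Q: "Q \<in> S" for Q
      proof -
        have RQ: "R \<inter> Q = Q" using S(2)[OF Q] by blast
        have "measure M (E (Suc j) k R s \<inter> Q) \<le> 3 * ?F Q + measure M Q * burkholder (?c Q) (t Q)"
          using Suc.IH[OF S(1)[OF Q], of "t Q"] EQ[OF Q] by simp
        also have "measure M Q * burkholder (?c Q) (t Q) \<le> measure M Q * (burkholder (?c R) s + l (?c Q - ?c R))"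
          using l(2)[of "?c Q - ?c R"] by (intro mult_left_mono) (simp_all add: t_def)
        also have "\<dots> = measure M Q * burkholder (?c R) s + l (measure M Q *\<^sub>R (?c Q - ?c R))"
          by (simp add: distrib_left l.scaleR)
        also have "measure M Q *\<^sub>R (?c Q - ?c R) = (LINT x:Q|M. f x) - measure M Q *\<^sub>R ?c R"
          using measure_average[OF S(1)[OF Q], of f] by (simp add: scaleR_diff_right)
        finally show ?thesis by (simp add: RQ l.diff l.scaleR)
      qed
      have mR: "((\<lambda>Q. measure M (R \<inter> Q)) has_sum measure M R) S"
        using subcells_has_sum_measure[OF R _ cells_sets[OF R]] by (simp add: S_def)
      \<comment> \<open>In the total the two \<open>l\<close> terms cancel, the integral over
        \<open>R\<close> being \<open>measure M R\<close> times the average.\<close>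
      have ub: "((\<lambda>Q. 3 * ?F Q + (measure M (R \<inter> Q) * burkholder (?c R) s
            + (l (LINT x:Q|M. f x) + measure M (R \<inter> Q) * - l (?c R)))) has_sum
          (3 * ?F R + (measure M R * burkholder (?c R) s
            + (l (LINT x:R|M. f x) + measure M R * - l (?c R))))) S"
        using subcells_has_sum[OF R _ f, of "k + 1"] subcells_has_sum[OF R _ integrable_norm[OF f], of "k + 1"]
        by (intro mR has_sum_add has_sum_cmult_right has_sum_cmult_left has_sum_bounded_linear[OF l(1)])
          (auto simp: S_def)
      have lb: "((\<lambda>Q. measure M (E (Suc j) k R s \<inter> Q)) has_sum measure M (E (Suc j) k R s)) S"
        using subcells_has_sum_measure[OF R _ E_sets, of "k + 1"] by (auto simp: S_def E_def)
      show ?thesis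
        using has_sum_mono[OF lb ub IH] E_sets by (simp add: l.scaleR flip: measure_average[OF R, of f])
    qed
  }
qed

subsection \<open>Stopping levels and the sparse family\<close>

lemma psum_scaleR: "psum \<epsilon> (\<lambda>x. c *\<^sub>R f x) m n x = c *\<^sub>R psum \<epsilon> f m n x"
  by (simp add: psum_def average_scaleR scaleR_sum_right flip: scaleR_diff_right)

text \<open>Homogeneity reduces the threshold \<open>c\<close> to 1, and the start 0 makes the
  Burkholder term nonpositive. The sets \<open>E j\<close> with finite horizon increase to
  \<open>W\<close>.\<close>

lemma weak_type:
  assumes f: "integrable M f" and \<epsilon>: "\<forall>P\<in>cells \<Q>. norm (\<epsilon> P) \<le> 1"
    and R: "R \<in> \<Q> k" and c: "0 < (c::real)"
  defines "W \<equiv> {x \<in> R. \<exists>n\<ge>k. c \<le> norm (psum \<epsilon> f k n x) \<or> c \<le> average M (\<lambda>y. norm (f y)) (cell n x)}"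
  shows "W \<in> sets M" "measure M W \<le> 3 / c * (LINT x:R|M. norm (f x))"
proof -
  define g where "g = (\<lambda>x. (1 / c) *\<^sub>R f x)"
  have g: "integrable M g"
    using f by (simp add: g_def)
  have norm_g: "(\<lambda>y. norm (g y)) = (\<lambda>y. (1 / c) *\<^sub>R norm (f y))"
    using c by (auto simp: g_def)
  define E where "E j = {x \<in> R. \<exists>i\<le>j. 1 \<le> norm (0 + psum \<epsilon> g k (k + int i) x)
        \<or> 1 \<le> average M (\<lambda>y. norm (g y)) (cell (k + int i) x)}" for j
  have E_iff: "x \<in> E j \<longleftrightarrow> x \<in> R \<and> (\<exists>i\<le>j. c \<le> norm (psum \<epsilon> f k (k + int i) x)
        \<or> c \<le> average M (\<lambda>y. norm (f y)) (cell (k + int i) x))" for x j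
    using c unfolding E_def norm_g average_scaleR unfolding g_def psum_scaleR by simp
  have E: "E j \<in> sets M" "measure M (E j) \<le> 3 / c * (LINT x:R|M. norm (f x))" for j
  proof -
    have "measure M R * burkholder (average M g R) 0 \<le> 0"
      by (simp add: burkholder_0_nonpos mult_nonneg_nonpos)
    moreover have "(LINT x:R|M. norm (g x)) = 1 / c * (LINT x:R|M. norm (f x))"
      unfolding norm_g set_lebesgue_integral_def by (simp add: mult.left_commute[of _ "1 / c"])
    moreover have step: "E j \<in> sets M \<and>
        measure M (E j) \<le> 3 * (LINT x:R|M. norm (g x)) + measure M R * burkholder (average M g R) 0"
      unfolding E_def by (rule burkholder_weak_type[OF g \<epsilon> R])
    ultimately show "measure M (E j) \<le> 3 / c * (LINT x:R|M. norm (f x))"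
      by simp
    show "E j \<in> sets M"
      using step by simp
  qed
  have W: "W = (\<Union>j. E j)"
  proof (intro set_eqI iffI)
    fix x assume "x \<in> W"
    then obtain n where "x \<in> R" "n \<ge> k"
        "c \<le> norm (psum \<epsilon> f k n x) \<or> c \<le> average M (\<lambda>y. norm (f y)) (cell n x)"
      by (auto simp: W_def)
    then have "x \<in> E (nat (n - k))"
      by (auto simp: E_iff intro!: exI[of _ "nat (n - k)"])
    then show "x \<in> (\<Union>j. E j)" by blast
  next
    fix x assume "x \<in> (\<Union>j. E j)"
    then obtain i :: nat where "x \<in> R" "c \<le> norm (psum \<epsilon> f k (k + int i) x)
        \<or> c \<le> average M (\<lambda>y. norm (f y)) (cell (k + int i) x)"
      by (auto simp: E_iff)
    then show "x \<in> W"
      unfolding W_def by (intro CollectI conjI exI[of _ "k + int i"]) auto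
  qed
  show W_sets: "W \<in> sets M"
    using E(1) W by auto
  have "emeasure M (\<Union>j. E j) \<noteq> \<infinity>"
    using emeasure_mono[of W R M] emeasure_cells[OF R] cells_sets[OF R]
    by (auto simp: W[symmetric] W_def top_unique)
  moreover have "incseq E"
    by (auto simp: incseq_def E_iff) (meson order_trans)+
  ultimately have "(\<lambda>j. measure M (E j)) \<longlonglongrightarrow> measure M W"
    unfolding W using E(1) by (intro Lim_measure_incseq) auto
  then show "measure M W \<le> 3 / c * (LINT x:R|M. norm (f x))"
    by (rule LIMSEQ_le_const2) (use E(2) in blast)
qed

lemma psum_const:
  assumes x: "x \<in> space M" and "cell n x = cell m x"
  shows "psum \<epsilon> f m n x = 0"
proof -
  have const: "cell k x = cell m x" if "m \<le> k" "k \<le> n" for k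
    using cell_antimono[OF x that(1)] cell_antimono[OF x that(2)] assms(2) by simp
  have "cell (k + 1) x = cell k x" if "k \<in> {m..<n}" for k
    using const[of k] const[of "k + 1"] that by simp
  then show ?thesis
    unfolding psum_def by (intro sum.neutral) simp
qed

section \<open>Bad levels relative to a stopping level\<close>

abbreviation avg :: "('a \<Rightarrow> complex) \<Rightarrow> 'a set \<Rightarrow> real" where
  "avg f Q \<equiv> average M (\<lambda>y. norm (f y)) Q"

text \<open>The inequalities are strict so that nothing is bad below a cell with average zero, and a
  level with an unchanged cell is never bad. Averages are tested too because the jump into the next
  stopping cell involves the average over the cell just before it.\<close>

definition bad :: "('a set \<Rightarrow> complex) \<Rightarrow> ('a \<Rightarrow> complex) \<Rightarrow> int \<Rightarrow> int \<Rightarrow> 'a \<Rightarrow> bool" where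
  "bad \<epsilon> f i n x \<longleftrightarrow> 6 * avg f (cell i x) < norm (psum \<epsilon> f i n x) \<or> 6 * avg f (cell i x) < avg f (cell n x)"

lemma bad_cong:
  assumes "x \<in> space M" "y \<in> cell n x" "i \<le> n"
  shows "bad \<epsilon> f i n y = bad \<epsilon> f i n x"
  using psum_cong[OF assms(1,2)] cell_cong_le[OF assms] cell_cong[OF assms(1,2)] by (simp add: bad_def)

lemma bad_cell_neq:
  assumes "x \<in> space M" "bad \<epsilon> f i n x"
  shows "cell n x \<noteq> cell i x"
proof
  assume eq: "cell n x = cell i x"
  show False
    using assms(2) average_norm_nonneg[of f "cell i x"] psum_const[OF assms(1) eq, of \<epsilon> f] eq
    by (auto simp: bad_def)
qed

text \<open>If the average over \<open>P\<close> is zero, so are all averages below and nothing is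
  bad. Otherwise \<open>weak_type\<close> at height \<open>6 * avg f P\<close> leaves
  \<open>3 / 6\<close> of the measure of \<open>P\<close>.\<close>

lemma bad_cover:
  assumes f: "integrable M f" and \<epsilon>: "\<forall>P\<in>cells \<Q>. norm (\<epsilon> P) \<le> 1" and P: "P \<in> \<Q> i"
  obtains W where "W \<in> sets M" "{x \<in> P. \<exists>n\<ge>i. bad \<epsilon> f i n x} \<subseteq> W" "emeasure M W \<le> emeasure M P / 2"
proof (cases "avg f P = 0")
  case True
  have cells_P: "cell n x \<in> \<Q> n" "cell n x \<subseteq> P" if "x \<in> P" "i \<le> n" for n x
  proof -
    have x: "x \<in> space M"
      using that cells_space[OF P] by blast
    show "cell n x \<in> \<Q> n" "cell n x \<subseteq> P"
      using cell(1)[OF x] cell_antimono[OF x \<open>i \<le> n\<close>] cell_eq[OF P \<open>x \<in> P\<close>] by auto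
  qed
  have zero: "avg f (cell n x) = 0" "average M f (cell n x) = 0" if "x \<in> P" "i \<le> n" for n x
  proof -
    note Q = cells_P[OF that]
    have "0 \<le> (LINT y:cell n x|M. norm (f y))"
      by (auto simp: set_lebesgue_integral_def intro!: integral_nonneg_AE)
    moreover have "(LINT y:cell n x|M. norm (f y)) \<le> (LINT y:P|M. norm (f y))"
      unfolding set_lebesgue_integral_def
      using set_integrable_cells[OF integrable_norm[OF f] Q(1)] set_integrable_cells[OF integrable_norm[OF f] P] Q(2)
      by (intro integral_mono) (auto simp: set_integrable_def indicator_def)
    moreover have "(LINT y:P|M. norm (f y)) = 0"
      using True measure_average[OF P, of "\<lambda>y. norm (f y)"] by simp
    ultimately show "avg f (cell n x) = 0"
      by (simp add: average_def)
    then show "average M f (cell n x) = 0"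
      using norm_average_le[OF f Q(1)] by simp
  qed
  have "\<not> bad \<epsilon> f i n x" if "x \<in> P" "i \<le> n" for n x
  proof -
    have "psum \<epsilon> f i n x = 0"
      unfolding psum_def using that(1) by (intro sum.neutral) (auto simp: zero(2))
    then show ?thesis
      using that by (simp add: bad_def zero(1))
  qed
  then have "{x \<in> P. \<exists>n\<ge>i. bad \<epsilon> f i n x} \<subseteq> {}" by blast
  then show ?thesis
    using that[of "{}"] by simp
next
  case False
  then have pos: "0 < avg f P"
    using average_norm_nonneg[of f P] by linarith
  define W where "W = {x \<in> P. \<exists>n\<ge>i. 6 * avg f P \<le> norm (psum \<epsilon> f i n x) \<or> 6 * avg f P \<le> avg f (cell n x)}"
  have "W \<in> sets M" "measure M W \<le> 3 / (6 * avg f P) * (LINT x:P|M. norm (f x))"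
    unfolding W_def using weak_type[OF f \<epsilon> P, where c = "6 * avg f P"] pos by simp_all
  moreover have "3 / (6 * avg f P) * (LINT x:P|M. norm (f x)) = measure M P / 2"
    using pos by (simp flip: measure_average[OF P])
  moreover have "emeasure M W \<noteq> \<infinity>"
    using emeasure_mono[of W P M] emeasure_cells[OF P] cells_sets[OF P] by (auto simp: W_def top_unique)
  ultimately have "W \<in> sets M" "emeasure M W \<le> ennreal (measure M P / 2)"
    by (simp_all add: emeasure_eq_ennreal_measure ennreal_leI)
  then have "W \<in> sets M" "emeasure M W \<le> emeasure M P / 2"
    using cells_emeasure[OF P] by (simp_all add: ennreal_divide_numeral)
  moreover have "{x \<in> P. \<exists>n\<ge>i. bad \<epsilon> f i n x} \<subseteq> W"
    using cell_eq[OF P] by (fastforce simp: W_def bad_def)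
  ultimately show ?thesis
    using that by blast
qed

text \<open>The last stopping level on the branch of \<open>x\<close> among \<open>n\<^sub>0\<close>
  to \<open>n\<^sub>0 + j\<close>; each new level is tested against the current stop. By
  \<open>stop_cong\<close> the cell at level \<open>n\<^sub>0 + j\<close> decides it, as for a
  stopping time.\<close>

primrec stop :: "('a set \<Rightarrow> complex) \<Rightarrow> ('a \<Rightarrow> complex) \<Rightarrow> int \<Rightarrow> nat \<Rightarrow> 'a \<Rightarrow> int" where
  "stop \<epsilon> f n\<^sub>0 0 x = n\<^sub>0"
| "stop \<epsilon> f n\<^sub>0 (Suc j) x =
    (if bad \<epsilon> f (stop \<epsilon> f n\<^sub>0 j x) (n\<^sub>0 + int (Suc j)) x then n\<^sub>0 + int (Suc j) else stop \<epsilon> f n\<^sub>0 j x)"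

lemma stop_ge: "n\<^sub>0 \<le> stop \<epsilon> f n\<^sub>0 j x"
  by (induction j) auto

lemma stop_le: "stop \<epsilon> f n\<^sub>0 j x \<le> n\<^sub>0 + int j"
  by (induction j) auto

lemma stop_mono: "i \<le> j \<Longrightarrow> stop \<epsilon> f n\<^sub>0 i x \<le> stop \<epsilon> f n\<^sub>0 j x"
proof (induction j rule: dec_induct)
  case (step j)
  then show ?case
    using stop_le[of \<epsilon> f n\<^sub>0 j x] by (auto simp del: of_nat_Suc simp: of_nat_Suc)
qed simp

lemma stop_cong:
  assumes "x \<in> space M" "y \<in> cell (n\<^sub>0 + int j) x"
  shows "stop \<epsilon> f n\<^sub>0 j y = stop \<epsilon> f n\<^sub>0 j x"
  using assms(2)
proof (induction j)
  case (Suc j)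
  have "y \<in> cell (n\<^sub>0 + int j) x"
    using cell_antimono[OF assms(1), of "n\<^sub>0 + int j" "n\<^sub>0 + int (Suc j)"] Suc.prems by auto
  note IH = Suc.IH[OF this]
  have "stop \<epsilon> f n\<^sub>0 j x \<le> n\<^sub>0 + int (Suc j)"
    using stop_le[of \<epsilon> f n\<^sub>0 j x] by simp
  then show ?case
    using bad_cong[OF assms(1) Suc.prems] by (simp add: IH del: of_nat_Suc)
qed simp

text \<open>Lets a stopping level \<open>i\<close> be recognized already at horizon
  \<open>i\<close>; by \<open>stop_cong\<close> all points of that cell then share the stop.\<close>

lemma stop_idem: "stop \<epsilon> f n\<^sub>0 (nat (stop \<epsilon> f n\<^sub>0 j x - n\<^sub>0)) x = stop \<epsilon> f n\<^sub>0 j x"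
proof (induction j)
  case (Suc j)
  show ?case
  proof (cases "bad \<epsilon> f (stop \<epsilon> f n\<^sub>0 j x) (n\<^sub>0 + int (Suc j)) x")
    case True
    then have "stop \<epsilon> f n\<^sub>0 (Suc j) x = n\<^sub>0 + int (Suc j)"
      by simp
    then show ?thesis
      by (metis add_diff_cancel_left' nat_int)
  next
    case False
    then show ?thesis
      using Suc by simp
  qed
qed simp

text \<open>Either the level is itself the stop, and then the cell is unchanged, or it was tested
  against the stop and found good.\<close>

lemma not_bad_stop:
  assumes "x \<in> space M"
  shows "\<not> bad \<epsilon> f (stop \<epsilon> f n\<^sub>0 j x) (n\<^sub>0 + int j) x"
proof
  assume bad: "bad \<epsilon> f (stop \<epsilon> f n\<^sub>0 j x) (n\<^sub>0 + int j) x"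
  have "stop \<epsilon> f n\<^sub>0 j x = n\<^sub>0 + int j"
    using bad by (cases j) (auto simp del: of_nat_Suc split: if_splits)
  then show False
    using bad_cell_neq[OF assms bad] by simp
qed

text \<open>\<open>12 * avg\<close> is a reserve for the next stop: 6 for the partial sum up to the
  level before it, and 6 for the average at that level, which enters the jump. A new cell needs its
  own reserve of 12 and one average for the jump, hence 13.\<close>

lemma psum_stop_bound:
  fixes n\<^sub>0 :: int
  assumes f: "integrable M f" and \<epsilon>: "\<forall>P\<in>cells \<Q>. norm (\<epsilon> P) \<le> 1" and x: "x \<in> space M"
  defines "G \<equiv> \<lambda>j. (\<lambda>i. cell (stop \<epsilon> f n\<^sub>0 i x) x) ` {..j}"
  shows "norm (psum \<epsilon> f n\<^sub>0 (stop \<epsilon> f n\<^sub>0 j x) x) + 12 * avg f (cell (stop \<epsilon> f n\<^sub>0 j x) x) \<le> 13 * sum (avg f) (G j)"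
proof (induction j)
  case 0
  then show ?case
    using average_norm_nonneg[of f "cell n\<^sub>0 x"] by (simp add: G_def psum_empty)
next
  case (Suc j)
  have G_Suc: "G (Suc j) = insert (cell (stop \<epsilon> f n\<^sub>0 (Suc j) x) x) (G j)"
    by (simp only: G_def atMost_Suc image_insert)
  show ?case
  proof (cases "bad \<epsilon> f (stop \<epsilon> f n\<^sub>0 j x) (n\<^sub>0 + int (Suc j)) x")
    case False
    then have "stop \<epsilon> f n\<^sub>0 (Suc j) x = stop \<epsilon> f n\<^sub>0 j x"
      by simp
    moreover from this have "G (Suc j) = G j"
      using G_Suc by (auto simp: G_def)
    ultimately show ?thesis
      using Suc by simp
  next
    case True
    define i n where "i = stop \<epsilon> f n\<^sub>0 j x" and "n = n\<^sub>0 + int j"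
    have i: "n\<^sub>0 \<le> i" "i \<le> n"
      using stop_ge stop_le by (auto simp: i_def n_def)
    have stop_Suc: "stop \<epsilon> f n\<^sub>0 (Suc j) x = n + 1"
      using True by (simp add: n_def)
    \<comment> \<open>The right-hand side sums over cells, not over stopping levels, so the new
      stopping cell has to differ from all earlier ones.\<close>
    have new: "cell (n + 1) x \<notin> G j"
    proof
      assume "cell (n + 1) x \<in> G j"
      then obtain l where "l \<le> j" "cell (n + 1) x = cell (stop \<epsilon> f n\<^sub>0 l x) x"
        by (auto simp: G_def)
      then have "cell i x \<subseteq> cell (n + 1) x"
        using cell_antimono[OF x stop_mono[of l j]] by (simp add: i_def)
      then have "cell (n + 1) x = cell i x"
        using cell_antimono[OF x, of i "n + 1"] i by auto
      then show False
        using bad_cell_neq[OF x True] by (simp add: i_def n_def ac_simps)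
    qed
    have finG: "finite (G j)"
      by (simp add: G_def)
    have good: "norm (psum \<epsilon> f i n x) \<le> 6 * avg f (cell i x)" "avg f (cell n x) \<le> 6 * avg f (cell i x)"
      using not_bad_stop[OF x, of \<epsilon> f n\<^sub>0 j] by (auto simp: bad_def i_def n_def)
    \<comment> \<open>The average over the new cell may be arbitrarily large compared with the old
      one, so it stays as a term of its own.\<close>
    have "norm (psum \<epsilon> f n (n + 1) x) \<le> 1 * (avg f (cell (n + 1) x) + avg f (cell n x))"
      unfolding psum_step norm_mult
    proof (rule mult_mono)
      show "norm (\<epsilon> (cell n x)) \<le> 1"
        using \<epsilon> cellsI[OF cell(1)[OF x]] by simp
      show "norm (average M f (cell (n + 1) x) - average M f (cell n x)) \<le> avg f (cell (n + 1) x) + avg f (cell n x)"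
        using norm_average_le[OF f cell(1)[OF x, of n]] norm_average_le[OF f cell(1)[OF x, of "n + 1"]]
          norm_triangle_ineq4[of "average M f (cell (n + 1) x)" "average M f (cell n x)"] by linarith
    qed auto
    moreover have "psum \<epsilon> f n\<^sub>0 (n + 1) x = psum \<epsilon> f n\<^sub>0 i x + psum \<epsilon> f i n x + psum \<epsilon> f n (n + 1) x"
      using i psum_add[of n\<^sub>0 i "n + 1" \<epsilon> f x] psum_add[of i n "n + 1" \<epsilon> f x] by simp
    then have "norm (psum \<epsilon> f n\<^sub>0 (n + 1) x)
        \<le> norm (psum \<epsilon> f n\<^sub>0 i x) + norm (psum \<epsilon> f i n x) + norm (psum \<epsilon> f n (n + 1) x)"
      by (metis add_right_mono norm_triangle_ineq norm_triangle_le)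
    moreover have "sum (avg f) (G (Suc j)) = avg f (cell (n + 1) x) + sum (avg f) (G j)"
      using new finG unfolding G_Suc stop_Suc by simp
    ultimately show ?thesis
      using Suc good unfolding stop_Suc i_def[symmetric] by simp
  qed
qed

text \<open>The last segment leads from a stop to a good level without a jump and uses only 6 of the
  reserve of 12.\<close>

lemma psum_bound:
  assumes f: "integrable M f" and \<epsilon>: "\<forall>P\<in>cells \<Q>. norm (\<epsilon> P) \<le> 1" and x: "x \<in> space M"
  shows "norm (psum \<epsilon> f n\<^sub>0 (n\<^sub>0 + int j) x) \<le> 13 * sum (avg f) ((\<lambda>i. cell (stop \<epsilon> f n\<^sub>0 i x) x) ` {..j})"
proof -
  define i n where "i = stop \<epsilon> f n\<^sub>0 j x" and "n = n\<^sub>0 + int j"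
  have i: "n\<^sub>0 \<le> i" "i \<le> n"
    using stop_ge stop_le by (auto simp: i_def n_def)
  have good: "norm (psum \<epsilon> f i n x) \<le> 6 * avg f (cell i x)"
    using not_bad_stop[OF x, of \<epsilon> f n\<^sub>0 j] by (auto simp: bad_def i_def n_def)
  have "norm (psum \<epsilon> f n\<^sub>0 n x) \<le> norm (psum \<epsilon> f n\<^sub>0 i x) + norm (psum \<epsilon> f i n x)"
    using psum_add[OF i, of \<epsilon> f x] by (simp add: norm_triangle_ineq)
  then show ?thesis
    using psum_stop_bound[OF f \<epsilon> x, where n\<^sub>0 = n\<^sub>0 and j = j] good average_norm_nonneg[of f "cell i x"]
    unfolding i_def[symmetric] n_def[symmetric] by linarith
qed

definition stopping_family :: "('a set \<Rightarrow> complex) \<Rightarrow> ('a \<Rightarrow> complex) \<Rightarrow> int \<Rightarrow> 'a set \<Rightarrow> 'a set set" where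
  "stopping_family \<epsilon> f n\<^sub>0 Q\<^sub>0 = (\<Union>x\<in>Q\<^sub>0. range (\<lambda>j. cell (stop \<epsilon> f n\<^sub>0 j x) x))"

text \<open>A cell may occur at several levels; the level obtained is one at which all its points
  stop.\<close>

lemma stopping_familyE:
  assumes "P \<in> stopping_family \<epsilon> f n\<^sub>0 Q\<^sub>0" "Q\<^sub>0 \<in> \<Q> n\<^sub>0"
  obtains i where "P \<in> \<Q> i" "n\<^sub>0 \<le> i" "\<And>x. x \<in> P \<Longrightarrow> stop \<epsilon> f n\<^sub>0 (nat (i - n\<^sub>0)) x = i"
proof -
  obtain y j where y: "y \<in> Q\<^sub>0" "P = cell (stop \<epsilon> f n\<^sub>0 j y) y"
    using assms(1) by (auto simp: stopping_family_def)
  define i where "i = stop \<epsilon> f n\<^sub>0 j y"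
  have ys: "y \<in> space M"
    using y(1) cells_space[OF assms(2)] by blast
  have i: "n\<^sub>0 \<le> i"
    by (simp add: i_def stop_ge)
  have "stop \<epsilon> f n\<^sub>0 (nat (i - n\<^sub>0)) x = i" if "x \<in> P" for x
    using stop_cong[OF ys, of x n\<^sub>0 "nat (i - n\<^sub>0)"] that i stop_idem[of \<epsilon> f n\<^sub>0 j y]
    by (simp add: y(2) flip: i_def)
  then show ?thesis
    using that[of i] i cell(1)[OF ys]
    by (simp add: y(2) flip: i_def)
qed

text \<open>If every later level were good relative to \<open>i\<close>, the stop of
  \<open>x\<close> would stay at \<open>i\<close>; but \<open>x\<close> also stops at the level of
  \<open>Q\<close>. Hence \<open>Q\<close> lies in the set covered by
  \<open>bad_cover\<close>.\<close>

lemma stopping_family_bad: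
  assumes Q\<^sub>0: "Q\<^sub>0 \<in> \<Q> n\<^sub>0" and P: "P \<in> \<Q> i" "n\<^sub>0 \<le> i"
    and stop_P: "\<And>x. x \<in> P \<Longrightarrow> stop \<epsilon> f n\<^sub>0 (nat (i - n\<^sub>0)) x = i"
    and Q: "Q \<in> stopping_family \<epsilon> f n\<^sub>0 Q\<^sub>0" "Q \<subset> P" and x: "x \<in> Q"
  shows "\<exists>n\<ge>i. bad \<epsilon> f i n x"
proof -
  obtain k where k: "Q \<in> \<Q> k" "n\<^sub>0 \<le> k" "\<And>x. x \<in> Q \<Longrightarrow> stop \<epsilon> f n\<^sub>0 (nat (k - n\<^sub>0)) x = k"
    using stopping_familyE[OF Q(1) Q\<^sub>0] by metis
  have xP: "x \<in> P" and xs: "x \<in> space M"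
    using x \<open>Q \<subset> P\<close> cells_space[OF P(1)] by auto
  have cP: "cell i x = P" and cQ: "cell k x = Q"
    using cell_eq P(1) xP k(1) x by auto
  have "i < k"
    using cell_antimono[OF xs, of k i] \<open>Q \<subset> P\<close> cP cQ by (cases "i < k") auto
  define st where "st j = stop \<epsilon> f n\<^sub>0 j x" for j
  define i' where "i' = nat (i - n\<^sub>0)"
  have st_Suc: "st (Suc j) = (if bad \<epsilon> f (st j) (n\<^sub>0 + int (Suc j)) x then n\<^sub>0 + int (Suc j) else st j)" for j
    by (simp add: st_def)
  have "\<exists>j\<ge>i'. bad \<epsilon> f i (n\<^sub>0 + int (Suc j)) x"
  proof (rule ccontr)
    assume not_bad: "\<not> ?thesis"
    have "st j = i" if "i' \<le> j" for j
      using that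
    proof (induction j rule: dec_induct)
      case base
      then show ?case
        using stop_P[OF xP] by (simp add: st_def i'_def)
    next
      case (step j)
      then show ?case
        using not_bad st_Suc[of j] by auto
    qed
    moreover have "i' \<le> nat (k - n\<^sub>0)"
      using \<open>i < k\<close> by (simp add: i'_def)
    ultimately show False
      using k(3)[OF x] \<open>i < k\<close> by (simp add: st_def)
  qed
  then obtain j where "i' \<le> j" "bad \<epsilon> f i (n\<^sub>0 + int (Suc j)) x"
    by blast
  moreover from this have "i \<le> n\<^sub>0 + int (Suc j)"
    by (simp add: i'_def)
  ultimately show ?thesis
    by blast
qed

lemma cells_nested:
  assumes "P \<in> cells \<Q>" "Q \<in> cells \<Q>" "x \<in> P" "x \<in> Q"
  shows "P \<subseteq> Q \<or> Q \<subseteq> P"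
proof -
  obtain m n where mn: "P \<in> \<Q> m" "Q \<in> \<Q> n"
    using assms(1,2) by (auto simp: cells_def)
  have "x \<in> space M"
    using cells_space[OF mn(1)] assms(3) by blast
  from cell_antimono[OF this, of m n] cell_antimono[OF this, of n m]
  show ?thesis
    using cell_eq[OF mn(1) assms(3)] cell_eq[OF mn(2) assms(4)] linear[of m n] by auto
qed

text \<open>Stopping children are disjoint, because overlapping cells are nested and only maximal
  ones count, and all of them lie in the set from \<open>bad_cover\<close>.\<close>

lemma sparse_stopping_family:
  assumes f: "integrable M f" and \<epsilon>: "\<forall>P\<in>cells \<Q>. norm (\<epsilon> P) \<le> 1" and Q\<^sub>0: "Q\<^sub>0 \<in> \<Q> n\<^sub>0"
  shows "sparse_family M \<Q> (stopping_family \<epsilon> f n\<^sub>0 Q\<^sub>0)" (is "sparse_family M \<Q> ?S")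
  unfolding sparse_family_def
proof
  show S_cells: "?S \<subseteq> cells \<Q>"
    using stopping_familyE[OF _ Q\<^sub>0] by (auto simp: cells_def) metis
  show "\<forall>P\<in>?S. (\<Sum>\<^sub>\<infinity>Q\<in>stopping_children ?S P. emeasure M Q) \<le> emeasure M P / 2"
  proof
    fix P assume "P \<in> ?S"
    then obtain i where i: "P \<in> \<Q> i" "n\<^sub>0 \<le> i" "\<And>x. x \<in> P \<Longrightarrow> stop \<epsilon> f n\<^sub>0 (nat (i - n\<^sub>0)) x = i"
      using stopping_familyE[OF _ Q\<^sub>0] by metis
    obtain W where W: "W \<in> sets M" "{x \<in> P. \<exists>n\<ge>i. bad \<epsilon> f i n x} \<subseteq> W" "emeasure M W \<le> emeasure M P / 2"
      using bad_cover[OF f \<epsilon> i(1)] by metis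
    let ?C = "stopping_children ?S P"
    have C: "Q \<in> ?S" "Q \<subset> P" "Q \<in> cells \<Q>" "Q \<in> sets M" if "Q \<in> ?C" for Q
      using that S_cells cells_sets by (auto simp: stopping_children_def cells_def)
    have C_W: "Q \<subseteq> W" if "Q \<in> ?C" for Q
      using stopping_family_bad[OF Q\<^sub>0 i C(1,2)[OF that]] C(2)[OF that] W(2) by blast
    have C_disj: "Q \<inter> R = {}" if QR: "Q \<in> ?C" "R \<in> ?C" "Q \<noteq> R" for Q R
    proof (rule ccontr)
      assume "Q \<inter> R \<noteq> {}"
      then have "Q \<subset> R \<or> R \<subset> Q"
        using cells_nested[OF C(3)[OF QR(1)] C(3)[OF QR(2)]] QR(3) by blast
      then show False
        using QR by (auto simp: stopping_children_def)
    qed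
    show "(\<Sum>\<^sub>\<infinity>Q\<in>?C. emeasure M Q) \<le> emeasure M P / 2"
    proof (rule infsum_le_finite_sums)
      fix F assume F: "finite F" "F \<subseteq> ?C"
      have "(\<Sum>Q\<in>F. emeasure M Q) = emeasure M (\<Union>Q\<in>F. Q)"
      proof (rule sum_emeasure)
        show "disjoint_family_on (\<lambda>Q. Q) F"
          unfolding disjoint_family_on_def using C_disj F(2) by (meson subsetD)
      qed (use F C(4) in auto)
      also have "\<dots> \<le> emeasure M W"
        using F C_W W(1) by (intro emeasure_mono) auto
      finally show "(\<Sum>Q\<in>F. emeasure M Q) \<le> emeasure M P / 2"
        using W(3) by (rule order_trans)
    qed (simp add: nonneg_summable_on_complete)
  qed
qed

text \<open>The additional \<open>avg f Q\<^sub>0\<close> is the price of the levels above, see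
  \<open>psum_top_bound\<close>. It is itself one of the averages in the sparse sum, which raises 13
  to 14.\<close>

lemma psum_sparse_bound:
  assumes f: "integrable M f" and \<epsilon>: "\<forall>P\<in>cells \<Q>. norm (\<epsilon> P) \<le> 1"
    and Q\<^sub>0: "Q\<^sub>0 \<in> \<Q> n\<^sub>0" and x: "x \<in> Q\<^sub>0"
  shows "ennreal (norm (psum \<epsilon> f n\<^sub>0 n x) + avg f Q\<^sub>0)
    \<le> 14 * sparse_operator M (stopping_family \<epsilon> f n\<^sub>0 Q\<^sub>0) (\<lambda>y. norm (f y)) x"
proof -
  have xs: "x \<in> space M"
    using x cells_space[OF Q\<^sub>0] by blast
  define j where "j = nat (n - n\<^sub>0)"
  define G where "G = (\<lambda>i. cell (stop \<epsilon> f n\<^sub>0 i x) x) ` {..j}"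
  have "norm (psum \<epsilon> f n\<^sub>0 n x) \<le> 13 * sum (avg f) G"
  proof (cases "n\<^sub>0 \<le> n")
    case True
    then show ?thesis
      using psum_bound[OF f \<epsilon> xs, where n\<^sub>0 = n\<^sub>0 and j = j] by (simp add: j_def G_def)
  qed (simp add: psum_empty sum_nonneg average_norm_nonneg)
  moreover have "avg f Q\<^sub>0 \<le> sum (avg f) G"
  proof (rule member_le_sum)
    show "Q\<^sub>0 \<in> G"
      using cell_eq[OF Q\<^sub>0 x] by (auto simp: G_def intro!: image_eqI[of _ _ 0])
  qed (auto simp: G_def average_norm_nonneg)
  ultimately have "ennreal (norm (psum \<epsilon> f n\<^sub>0 n x) + avg f Q\<^sub>0) \<le> ennreal (14 * sum (avg f) G)"
    by (intro ennreal_leI) simp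
  also have "\<dots> = 14 * (\<Sum>P\<in>G. ennreal (avg f P) * indicator P x)"
  proof -
    have "(\<Sum>P\<in>G. ennreal (avg f P) * indicator P x) = (\<Sum>P\<in>G. ennreal (avg f P))"
      using cell(2)[OF xs] by (intro sum.cong) (auto simp: G_def)
    then show ?thesis
      by (simp add: ennreal_mult' sum_ennreal average_norm_nonneg)
  qed
  also have "(\<Sum>P\<in>G. ennreal (avg f P) * indicator P x)
      = (\<Sum>\<^sub>\<infinity>P\<in>G. ennreal (avg f P) * indicator P x)"
    by (simp add: G_def)
  also have "\<dots> \<le> sparse_operator M (stopping_family \<epsilon> f n\<^sub>0 Q\<^sub>0) (\<lambda>y. norm (f y)) x"
    unfolding sparse_operator_def
    using x by (intro infsum_mono_neutral) (auto simp: nonneg_summable_on_complete G_def stopping_family_def)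
  finally show ?thesis
    by (simp add: mult_left_mono)
qed

subsection \<open>From martingale differences to sums over levels\<close>

lemma set_integral_supported:
  fixes f :: "'a \<Rightarrow> complex"
  assumes "AE x in M. x \<notin> Q\<^sub>0 \<longrightarrow> f x = 0" "integrable M f" "P \<in> sets M"
  shows "Q\<^sub>0 \<subseteq> P \<Longrightarrow> (LINT x:P|M. f x) = (LINT x|M. f x)"
    and "Q\<^sub>0 \<inter> P = {} \<Longrightarrow> (LINT x:P|M. f x) = 0"
proof -
  note [measurable] = borel_measurable_integrable[OF assms(2)] assms(3)
  show "(LINT x:P|M. f x) = (LINT x|M. f x)" if "Q\<^sub>0 \<subseteq> P"
    unfolding set_lebesgue_integral_def
    using assms(1) that by (intro integral_cong_AE) (auto simp: indicator_def)
  have "(LINT x:P|M. f x) = (LINT x|M. 0)" if "Q\<^sub>0 \<inter> P = {}"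
    unfolding set_lebesgue_integral_def
    using assms(1) that by (intro integral_cong_AE) (auto simp: indicator_def elim!: eventually_mono)
  then show "(LINT x:P|M. f x) = 0" if "Q\<^sub>0 \<inter> P = {}"
    using that by simp
qed

text \<open>Going up from \<open>x\<close>, either some cell contains \<open>Q\<^sub>0\<close>, and
  the integral is the full one, or no cell at level at most \<open>n\<^sub>0\<close> meets it, and
  the integral is 0. The second case is possible since two points need not have a common
  cell.\<close>

lemma integral_eventually_const:
  fixes f :: "'a \<Rightarrow> complex"
  assumes "AE x in M. x \<notin> Q\<^sub>0 \<longrightarrow> f x = 0" "integrable M f" "Q\<^sub>0 \<in> \<Q> n\<^sub>0" and x: "x \<in> space M"
  obtains k J where "k \<le> n\<^sub>0" "\<And>i. i \<le> k \<Longrightarrow> (LINT y:cell i x|M. f y) = J"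
proof (cases "\<exists>k\<le>n\<^sub>0. Q\<^sub>0 \<subseteq> cell k x")
  case True
  then obtain k where k: "k \<le> n\<^sub>0" "Q\<^sub>0 \<subseteq> cell k x"
    by blast
  have "(LINT y:cell i x|M. f y) = (LINT y|M. f y)" if "i \<le> k" for i
    using set_integral_supported(1)[OF assms(1,2) cells_sets[OF cell(1)[OF x]]]
      cell_antimono[OF x that] k(2) by blast
  then show ?thesis
    using that k(1) by blast
next
  case False
  have "Q\<^sub>0 \<inter> cell i x = {}" if "i \<le> n\<^sub>0" for i
  proof (rule ccontr)
    assume "Q\<^sub>0 \<inter> cell i x \<noteq> {}"
    then obtain y where y: "y \<in> Q\<^sub>0" "y \<in> cell i x"
      by auto
    then have "y \<in> space M"
      using cells_space[OF assms(3)] by auto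
    then have "Q\<^sub>0 \<subseteq> cell i x"
      using cell_antimono[OF _ that, of y] cell_cong[OF x y(2)] cell_eq[OF assms(3) y(1)] by simp
    then show False
      using False that by simp
  qed
  then have "(LINT y:cell i x|M. f y) = 0" if "i \<le> n\<^sub>0" for i
    using set_integral_supported(2)[OF assms(1,2) cells_sets[OF cell(1)[OF x]]] that by simp
  then show ?thesis
    using that[of n\<^sub>0] by simp
qed

text \<open>Where the integrals over the cells do not change, the averages of \<^term>\<open>f\<close> differ only by the
  factor \<^term>\<open>1 / measure M (cell k x)\<close>, which is monotone in \<^term>\<open>k\<close>; so the sum telescopes.\<close>

lemma sum_norm_average_diff_le:
  fixes f :: "'a \<Rightarrow> complex"
  assumes x: "x \<in> space M" and J: "\<And>i. i \<le> n \<Longrightarrow> (LINT y:cell i x|M. f y) = J" and "m \<le> n"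
  shows "(\<Sum>k\<in>{m..<n}. norm (average M f (cell (k + 1) x) - average M f (cell k x)))
    \<le> norm J / measure M (cell n x)"
proof -
  define w where "w k = 1 / measure M (cell k x)" for k
  have w: "w k \<le> w (k + 1)" for k
  proof -
    have "measure M (cell (k + 1) x) \<le> measure M (cell k x)"
      using cells_sets[OF cell(1)[OF x]] emeasure_cells[OF cell(1)[OF x]]
      by (intro measure_mono_fmeasurable cell_Suc_subset[OF x]) (simp_all add: fmeasurable_def)
    then show ?thesis
      using measure_cells_pos[OF cell(1)[OF x]] by (simp add: w_def frac_le)
  qed
  have avg: "average M f (cell k x) = w k *\<^sub>R J" if "k \<le> n" for k
    using J[OF that] by (simp add: average_def w_def)
  have "(\<Sum>k\<in>{m..<i}. norm (average M f (cell (k + 1) x) - average M f (cell k x)))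
      = norm J * (w i - w m)" if "m \<le> i" "i \<le> n" for i
    using that
  proof (induction i rule: int_ge_induct)
    case (step i)
    have "{m..<i + 1} = insert i {m..<i}"
      using step(1) by auto
    moreover have "norm (average M f (cell (i + 1) x) - average M f (cell i x)) = norm J * (w (i + 1) - w i)"
      using step w[of i] by (simp add: avg abs_of_nonneg flip: scaleR_diff_left)
    ultimately show ?case
      using step by (simp add: algebra_simps)
  qed simp
  from this[OF \<open>m \<le> n\<close>] have "(\<Sum>k\<in>{m..<n}. norm (average M f (cell (k + 1) x) - average M f (cell k x)))
      = norm J * (w n - w m)"
    by simp
  also have "\<dots> \<le> norm J * w n"
    by (intro mult_left_mono) (auto simp: w_def)
  finally show ?thesis
    by (simp add: w_def)
qed

lemma norm_psum_le:
  assumes "x \<in> space M" "\<forall>P\<in>cells \<Q>. norm (\<epsilon> P) \<le> 1"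
  shows "norm (psum \<epsilon> f m n x) \<le> (\<Sum>k\<in>{m..<n}. norm (average M f (cell (k + 1) x) - average M f (cell k x)))"
  unfolding psum_def using assms cellsI[OF cell(1)[OF assms(1)]]
  by (intro sum_norm_le) (simp add: norm_mult mult_left_le_one_le)

text \<open>Cells of \<open>x\<close> above level \<open>n\<^sub>0\<close> contain the support, so
  the telescoping bound applies and is uniform in \<open>m\<close>.\<close>

lemma psum_top_bound:
  assumes supp: "AE x in M. x \<notin> Q\<^sub>0 \<longrightarrow> f x = 0" and f: "integrable M f"
    and \<epsilon>: "\<forall>P\<in>cells \<Q>. norm (\<epsilon> P) \<le> 1" and Q\<^sub>0: "Q\<^sub>0 \<in> \<Q> n\<^sub>0" and x: "x \<in> Q\<^sub>0" and "m \<le> n\<^sub>0"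
  shows "norm (psum \<epsilon> f m n x) \<le> norm (psum \<epsilon> f n\<^sub>0 n x) + avg f Q\<^sub>0"
proof -
  have xs: "x \<in> space M"
    using x cells_space[OF Q\<^sub>0] by blast
  have c: "cell n\<^sub>0 x = Q\<^sub>0"
    using cell_eq[OF Q\<^sub>0 x] .
  have J: "(LINT y:cell i x|M. f y) = (LINT y|M. f y)" if "i \<le> n\<^sub>0" for i
    using set_integral_supported(1)[OF supp f cells_sets[OF cell(1)[OF xs]]] cell_antimono[OF xs that] c
    by simp
  have top: "(\<Sum>k\<in>{m..<n\<^sub>0}. norm (average M f (cell (k + 1) x) - average M f (cell k x))) \<le> avg f Q\<^sub>0"
  proof -
    have "norm (LINT y|M. f y) / measure M Q\<^sub>0 = norm (average M f Q\<^sub>0)"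
      using J[of n\<^sub>0] by (simp add: c average_def)
    also have "\<dots> \<le> avg f Q\<^sub>0"
      by (rule norm_average_le[OF f Q\<^sub>0])
    finally show ?thesis
      using sum_norm_average_diff_le[OF xs J \<open>m \<le> n\<^sub>0\<close>] c by simp
  qed
  show ?thesis
  proof (cases "n\<^sub>0 \<le> n")
    case True
    then show ?thesis
      using psum_add[OF \<open>m \<le> n\<^sub>0\<close> True, of \<epsilon> f x] norm_psum_le[OF xs \<epsilon>, of f m n\<^sub>0] top
        norm_triangle_ineq[of "psum \<epsilon> f m n\<^sub>0 x" "psum \<epsilon> f n\<^sub>0 n x"] by simp
  next
    case False
    then have "(\<Sum>k\<in>{m..<n}. norm (average M f (cell (k + 1) x) - average M f (cell k x)))
       \<le> (\<Sum>k\<in>{m..<n\<^sub>0}. norm (average M f (cell (k + 1) x) - average M f (cell k x)))"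
      by (intro sum_mono2) auto
    then show ?thesis
      using norm_psum_le[OF xs \<epsilon>, of f m n] top norm_ge_zero[of "psum \<epsilon> f n\<^sub>0 n x"] by linarith
  qed
qed

text \<open>Above level \<open>k\<close> the same telescoping bound gives absolute summability;
  finitely many summands remain down to \<open>n\<^sub>0\<close>.\<close>

lemma psum_tendsto_at_bot:
  assumes supp: "AE x in M. x \<notin> Q\<^sub>0 \<longrightarrow> f x = 0" and f: "integrable M f"
    and \<epsilon>: "\<forall>P\<in>cells \<Q>. norm (\<epsilon> P) \<le> 1" and Q\<^sub>0: "Q\<^sub>0 \<in> \<Q> n\<^sub>0" and x: "x \<in> space M"
  obtains l where "((\<lambda>m. psum \<epsilon> f m n\<^sub>0 x) \<longlongrightarrow> l) at_bot"
proof -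
  obtain k J where k: "k \<le> n\<^sub>0" "\<And>i. i \<le> k \<Longrightarrow> (LINT y:cell i x|M. f y) = J"
    using integral_eventually_const[OF supp f Q\<^sub>0 x] by metis
  define d where "d i = \<epsilon> (cell i x) * (average M f (cell (i + 1) x) - average M f (cell i x))" for i
  have "(\<lambda>i. norm (d i)) summable_on {..<k}"
  proof (rule nonneg_bounded_partial_sums_imp_summable_on)
    show "eventually (\<lambda>F. (\<Sum>i\<in>F. norm (d i)) \<le> norm J / measure M (cell k x)) (finite_subsets_at_top {..<k})"
    proof (rule eventually_finite_subsets_at_top_weakI)
      fix F :: "int set" assume F: "finite F" "F \<subseteq> {..<k}"
      define m where "m = Min (insert k F)"
      have m: "m \<le> k" "F \<subseteq> {m..<k}"
        using F by (auto simp: m_def)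
      have "(\<Sum>i\<in>F. norm (d i)) \<le> (\<Sum>i\<in>{m..<k}. norm (d i))"
        using m by (intro sum_mono2) auto
      also have "\<dots> \<le> (\<Sum>i\<in>{m..<k}. norm (average M f (cell (i + 1) x) - average M f (cell i x)))"
        using \<epsilon> cellsI[OF cell(1)[OF x]]
        by (intro sum_mono) (simp add: d_def norm_mult mult_left_le_one_le)
      also have "\<dots> \<le> norm J / measure M (cell k x)"
        using sum_norm_average_diff_le[OF x k(2) m(1)] by simp
      finally show "(\<Sum>i\<in>F. norm (d i)) \<le> norm J / measure M (cell k x)" .
    qed
  qed auto
  then obtain l where "(d has_sum l) {..<k}"
    using abs_summable_summable summable_on_def by blast
  then have "(sum d \<longlongrightarrow> l) (finite_subsets_at_top {..<k})"
    by (simp add: has_sum_def)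
  moreover have "filterlim (\<lambda>m. {m..<k}) (finite_subsets_at_top {..<k}) at_bot"
    unfolding filterlim_finite_subsets_at_top
  proof safe
    fix X assume X: "finite X" "X \<subseteq> {..<k}"
    have "\<forall>\<^sub>F m in at_bot. m \<le> Min (insert k X)"
      by (rule eventually_le_at_bot)
    then show "\<forall>\<^sub>F m in at_bot. finite {m..<k} \<and> X \<subseteq> {m..<k} \<and> {m..<k} \<subseteq> {..<k}"
      using X by (elim eventually_mono) auto
  qed
  ultimately have "((\<lambda>m. sum d {m..<k}) \<longlongrightarrow> l) at_bot"
    by (rule filterlim_compose)
  then have "((\<lambda>m. sum d {m..<k} + psum \<epsilon> f k n\<^sub>0 x) \<longlongrightarrow> l + psum \<epsilon> f k n\<^sub>0 x) at_bot"
    by (intro tendsto_intros)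
  moreover have "\<forall>\<^sub>F m in at_bot. sum d {m..<k} + psum \<epsilon> f k n\<^sub>0 x = psum \<epsilon> f m n\<^sub>0 x"
    using eventually_le_at_bot[of k]
  proof eventually_elim
    case (elim m)
    show ?case
      using psum_add[OF elim k(1), of \<epsilon> f x] by (simp add: psum_def d_def)
  qed
  ultimately have "((\<lambda>m. psum \<epsilon> f m n\<^sub>0 x) \<longlongrightarrow> l + psum \<epsilon> f k n\<^sub>0 x) at_bot"
    by (rule Lim_transform_eventually)
  then show ?thesis
    by (rule that)
qed

section \<open>Martingale differences along the chain of a point\<close>

lemma mart_diff_cell:
  assumes x: "x \<in> space M" and neq: "cell (n + 1) x \<noteq> cell n x"
  shows "mart_diff M \<Q> (cell n x) f x = average M f (cell (n + 1) x) - average M f (cell n x)"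
proof -
  let ?P = "cell n x" and ?Q = "cell (n + 1) x"
  have QP: "?Q \<subset> ?P"
    using cell_Suc_subset[OF x, of n] neq by auto
  \<comment> \<open>No cell containing \<open>x\<close> lies strictly between two consecutive
    levels. So the next cell is a child, and the only one that contains \<open>x\<close>.\<close>
  have between: "cell n x \<subseteq> R \<or> R \<subseteq> ?Q" if R: "R \<in> cells \<Q>" "x \<in> R" for R
  proof -
    obtain r where r: "R \<in> \<Q> r"
      using R(1) by (auto simp: cells_def)
    have "r \<le> n \<or> n + 1 \<le> r"
      by linarith
    then show ?thesis
      using cell_antimono[OF x, of r n] cell_antimono[OF x, of "n + 1" r] cell_eq[OF r R(2)] by auto
  qed
  have Q: "?Q \<in> children \<Q> ?P"
    unfolding children_def is_parent_def
  proof (intro CollectI conjI notI)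
    assume "\<exists>R\<in>cells \<Q>. ?Q \<subset> R \<and> R \<subset> ?P"
    then obtain R where "R \<in> cells \<Q>" "?Q \<subset> R" "R \<subset> ?P"
      by blast
    then show False
      using between[of R] cell(2)[OF x, of "n + 1"] by blast
  qed (use QP cell(1)[OF x] in \<open>auto intro: cellsI\<close>)
  have unique: "x \<notin> R" if R: "R \<in> children \<Q> ?P" "R \<noteq> ?Q" for R
  proof
    assume "x \<in> R"
    moreover have "R \<in> cells \<Q>" "R \<subset> ?P" "\<not> (R \<subset> ?Q \<and> ?Q \<subset> ?P)"
      using R(1) cellsI[OF cell(1)[OF x]] by (auto simp: children_def is_parent_def)
    ultimately show False
      using between[of R] QP R(2) by blast
  qed
  have "mart_diff M \<Q> ?P f x =
      (\<Sum>\<^sub>\<infinity>R\<in>{?Q}. indicator R x * (average M f R - average M f ?P))"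
    unfolding mart_diff_def using Q unique by (intro infsum_cong_neutral) auto
  then show ?thesis
    using cell(2)[OF x] by simp
qed

text \<open>Serves two situations: \<open>x\<close> outside \<open>P\<close>, where the second
  hypothesis is vacuous, and a cell that never shrinks at \<open>x\<close>. A child containing
  \<open>x\<close> would have to appear at a later level.\<close>

lemma mart_diff_eq_0:
  assumes P: "P \<in> cells \<Q>" and "x \<in> P \<Longrightarrow> x \<in> space M \<Longrightarrow> (\<forall>n. cell n x = P \<longrightarrow> cell (n + 1) x = P)"
  shows "mart_diff M \<Q> P f x = 0"
proof -
  have "x \<notin> Q" if "Q \<in> children \<Q> P" for Q
  proof
    assume xQ: "x \<in> Q"
    have "Q \<in> cells \<Q>" "Q \<subset> P"
      using that by (auto simp: children_def is_parent_def)
    then obtain k r where kr: "P \<in> \<Q> k" "Q \<in> \<Q> r" "Q \<subset> P"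
      using P by (auto simp: cells_def)
    then have xP: "x \<in> P" and xs: "x \<in> space M"
      using xQ cells_space by auto
    have eq: "cell k x = P" "cell r x = Q"
      using cell_eq kr xP xQ by auto
    have "k \<le> r"
      using cell_antimono[OF xs, of r k] eq kr(3) by (cases "k \<le> r") auto
    then have "cell r x = P"
      by (induction r rule: int_ge_induct) (use eq(1) assms(2) xP xs in auto)
    then show False
      using eq kr(3) by simp
  qed
  then show ?thesis
    unfolding mart_diff_def by (intro infsum_0) auto
qed

text \<open>A cell that persists until level \<open>n\<close> may split only later, so the level-wise sum has to be
  continued up to the level at which it does.\<close>

lemma sum_mart_diff_eq_psum:
  assumes x: "x \<in> space M" and "m \<le> n"
  obtains n' where "n \<le> n'"
    "(\<Sum>P\<in>(\<lambda>k. cell k x) ` {m..n}. \<epsilon> P * mart_diff M \<Q> P f x) = psum \<epsilon> f m n' x"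
proof -
  \<comment> \<open>If the cell persists for ever, any later level will do; otherwise
    \<open>n'\<close> is the first level at which it has shrunk.\<close>
  obtain n' where n': "n < n'" "\<And>k. n \<le> k \<Longrightarrow> k < n' \<Longrightarrow> cell k x = cell n x"
    "(\<forall>k\<ge>n. cell k x = cell n x) \<or> cell n' x \<noteq> cell n x"
  proof (cases "\<forall>k\<ge>n. cell k x = cell n x")
    case True
    show ?thesis
    proof (rule that[of "n + 1"])
      show "cell k x = cell n x" if "n \<le> k" for k
        using True that by blast
    qed (use True in \<open>blast | simp\<close>)+
  next
    case False
    define Z where "Z j \<longleftrightarrow> cell (n + int j) x \<noteq> cell n x" for j
    obtain k where "n \<le> k" "cell k x \<noteq> cell n x"
      using False by blast
    then have "Z (nat (k - n))"
      by (simp add: Z_def)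
    then have Z: "Z (LEAST j. Z j)"
      by (rule LeastI)
    show ?thesis
    proof (rule that[of "n + int (LEAST j. Z j)"])
      show "n < n + int (LEAST j. Z j)"
        using Z by (cases "LEAST j. Z j") (auto simp: Z_def)
      show "cell k x = cell n x" if "n \<le> k" "k < n + int (LEAST j. Z j)" for k
        using not_less_Least[of "nat (k - n)" Z] that by (auto simp: Z_def)
    qed (use Z in \<open>simp add: Z_def\<close>)
  qed
  \<comment> \<open>The levels at which the cell of \<open>x\<close> shrinks. Each cell of the chain
    is left at most once, so \<open>D\<close> counts cells without repetition; a level of
    \<open>D\<close> beyond \<open>n\<close> still carries \<open>cell n x\<close>.\<close>
  define D where "D = {k \<in> {m..<n'}. cell (k + 1) x \<noteq> cell k x}"
  have inj: "inj_on (\<lambda>k. cell k x) D"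
  proof (rule linorder_inj_onI)
    fix i j assume ij: "i < j" "i \<in> D" "j \<in> D"
    have "cell j x \<subseteq> cell (i + 1) x"
      using ij by (intro cell_antimono[OF x]) simp
    then show "cell i x \<noteq> cell j x"
      using ij cell_Suc_subset[OF x, of i] by (auto simp: D_def)
  qed auto
  have "psum \<epsilon> f m n' x = (\<Sum>k\<in>D. \<epsilon> (cell k x) * mart_diff M \<Q> (cell k x) f x)"
    unfolding psum_def
    by (rule sum.mono_neutral_cong_right) (auto simp: D_def mart_diff_cell[OF x])
  also have "\<dots> = (\<Sum>P\<in>(\<lambda>k. cell k x) ` D. \<epsilon> P * mart_diff M \<Q> P f x)"
    by (simp add: sum.reindex[OF inj])
  also have "\<dots> = (\<Sum>P\<in>(\<lambda>k. cell k x) ` {m..n}. \<epsilon> P * mart_diff M \<Q> P f x)"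
  proof (rule sum.mono_neutral_left)
    show "(\<lambda>k. cell k x) ` D \<subseteq> (\<lambda>k. cell k x) ` {m..n}"
    proof safe
      fix k assume k: "k \<in> D"
      show "cell k x \<in> (\<lambda>k. cell k x) ` {m..n}"
      proof (cases "k \<le> n")
        case False
        then show ?thesis
          using n'(2)[of k] k \<open>m \<le> n\<close> by (auto simp: D_def)
      qed (use k in \<open>auto simp: D_def\<close>)
    qed
    show "\<forall>P\<in>(\<lambda>k. cell k x) ` {m..n} - (\<lambda>k. cell k x) ` D. \<epsilon> P * mart_diff M \<Q> P f x = 0"
    proof
      fix P assume "P \<in> (\<lambda>k. cell k x) ` {m..n} - (\<lambda>k. cell k x) ` D"
      then obtain k where k: "m \<le> k" "k \<le> n" "P = cell k x" and D: "P \<notin> (\<lambda>k. cell k x) ` D"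
        by auto
      \<comment> \<open>A cell from the levels \<open>m\<close> to \<open>n\<close> that is not left
        before \<open>n'\<close> is never left, so its martingale difference vanishes at
        \<open>x\<close>.\<close>
      have "cell (l + 1) x = P" if l: "cell l x = P" for l
      proof (rule ccontr)
        assume neq: "cell (l + 1) x \<noteq> P"
        have "m \<le> l"
          using cell_antimono[OF x, of "l + 1" k] cell_Suc_subset[OF x, of l] k l neq by (cases "m \<le> l") auto
        moreover have "l < n'"
        proof (rule ccontr)
          assume "\<not> l < n'"
          then have "cell l x \<subseteq> cell n' x" "cell n' x \<subseteq> cell n x" "cell n x \<subseteq> P"
            using cell_antimono[OF x] n'(1) k by simp_all
          then have "cell n' x = cell n x"
            using l by simp
          then have "cell (l + 1) x = cell l x"
            using n'(1,3) \<open>\<not> l < n'\<close> by (metis add_increasing2 linorder_not_le order.strict_trans1 order_less_imp_le zero_le_one)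
          then show False
            using neq l by simp
        qed
        ultimately show False
          using D neq l by (auto simp: D_def)
      qed
      then show "\<epsilon> P * mart_diff M \<Q> P f x = 0"
        using mart_diff_eq_0[OF cellsI[OF cell(1)[OF x, of k]], of x f] k(3) by simp
    qed
  qed auto
  finally show ?thesis
    using that[of n'] n'(1) by simp
qed

text \<open>Partial sums over arbitrary finite sets of cells are not controlled, but every such set
  lies in a finite interval of the chain, where the sum is a \<open>psum\<close>. These intervals
  are cofinal, so the limit inherits the bound.\<close>

lemma norm_truncation_le:
  assumes x: "x \<in> space M" and Q: "Q' \<in> cells \<Q>"
    and B: "\<And>m n. m \<le> n\<^sub>0 \<Longrightarrow> norm (psum \<epsilon> f m n x) \<le> B" and "0 \<le> B"
  shows "norm (\<Sum>\<^sub>\<infinity>Q\<in>{Q \<in> cells \<Q>. Q' \<subseteq> Q}. \<epsilon> Q * mart_diff M \<Q> Q f x) \<le> B"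
proof -
  let ?t = "\<lambda>Q. \<epsilon> Q * mart_diff M \<Q> Q f x"
  define D where "D = {Q \<in> cells \<Q>. Q' \<subseteq> Q \<and> x \<in> Q}"
  have "infsum ?t {Q \<in> cells \<Q>. Q' \<subseteq> Q} = infsum ?t D"
  proof (rule infsum_cong_neutral)
    fix Q assume "Q \<in> {Q \<in> cells \<Q>. Q' \<subseteq> Q} - D"
    then have "Q \<in> cells \<Q>" "x \<notin> Q"
      by (auto simp: D_def)
    then show "?t Q = 0"
      using mart_diff_eq_0[of Q x f] by simp
  qed (auto simp: D_def)
  moreover have "norm (infsum ?t D) \<le> B"
  proof (cases "?t summable_on D \<and> D \<noteq> {}")
    \<comment> \<open>A sum that does not converge has the default value 0, as has the empty
      sum.\<close>
    case False
    then show ?thesis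
      using \<open>0 \<le> B\<close> by (auto simp: infsum_not_exists)
  next
    case True
    then have lim: "(sum ?t \<longlongrightarrow> infsum ?t D) (finite_subsets_at_top D)"
      by (simp add: flip: has_sum_def)
    have D_cell: "\<exists>k. Q = cell k x" if "Q \<in> D" for Q
      using that cell_eq by (auto simp: D_def cells_def)
    have ex: "\<exists>F. finite F \<and> X \<subseteq> F \<and> F \<subseteq> D \<and> norm (sum ?t F) \<le> B" if X: "finite X" "X \<subseteq> D" for X
    proof -
      obtain P where P: "P \<in> D"
        using True by blast
      obtain J where J: "finite J" "insert P X = (\<lambda>k. cell k x) ` J"
        using finite_subset_image[of "insert P X" "\<lambda>k. cell k x" UNIV] D_cell X P by blast
      then have "J \<noteq> {}"
        by auto
      \<comment> \<open>Inserting \<open>P\<close> made \<open>J\<close> nonempty, so its maximum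
        names a cell of \<open>D\<close>. That cell contains \<open>Q'\<close>, hence so does the
        whole interval. Inserting \<open>n\<^sub>0\<close> makes the bound \<open>B\<close>
        applicable.\<close>
      define m n where "m = Min (insert n\<^sub>0 J)" and "n = Max J"
      define F where "F = (\<lambda>k. cell k x) ` {m..n}"
      have m: "m \<le> n\<^sub>0" and J_mn: "J \<subseteq> {m..n}"
        using J(1) by (auto simp: m_def n_def)
      have "n \<in> J"
        using J(1) \<open>J \<noteq> {}\<close> by (simp add: n_def)
      then have "cell n x \<in> insert P X"
        unfolding J(2) by (rule imageI)
      then have "cell n x \<in> D"
        using X(2) P by auto
      then have "Q' \<subseteq> cell n x"
        by (simp add: D_def)
      then have "F \<subseteq> D"
        using cell_antimono[OF x, of _ n] cellsI[OF cell(1)[OF x]] cell(2)[OF x]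
        unfolding F_def D_def by fastforce
      moreover have "insert P X \<subseteq> F"
        unfolding J(2) F_def using J_mn by (rule image_mono)
      moreover have "norm (sum ?t F) \<le> B"
        using sum_mart_diff_eq_psum[OF x, of m n \<epsilon> f] B[OF m] \<open>n \<in> J\<close> J_mn unfolding F_def
        by (metis atLeastAtMost_iff subsetD)
      ultimately show ?thesis
        by (auto simp: F_def)
    qed
    show ?thesis
    proof (rule ccontr)
      assume "\<not> ?thesis"
      then have "\<forall>\<^sub>F F in finite_subsets_at_top D. B < norm (sum ?t F)"
        using order_tendstoD(1)[OF tendsto_norm[OF lim]] by simp
      then obtain X where "finite X" "X \<subseteq> D"
          "\<And>F. finite F \<Longrightarrow> X \<subseteq> F \<Longrightarrow> F \<subseteq> D \<Longrightarrow> B < norm (sum ?t F)"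
        unfolding eventually_finite_subsets_at_top by metis
      then show False
        using ex[of X] by force
    qed
  qed
  ultimately show ?thesis
    by simp
qed

subsection \<open>Almost everywhere convergence\<close>

definition adapted :: "int \<Rightarrow> ('a \<Rightarrow> 'b) \<Rightarrow> bool" where
  "adapted n g \<longleftrightarrow> (\<forall>x\<in>space M. \<forall>y\<in>cell n x. g y = g x)"

lemma adapted_mono: "adapted m g \<Longrightarrow> m \<le> n \<Longrightarrow> adapted n g"
  using cell_antimono unfolding adapted_def by blast

lemma adapted_indicator_cells:
  assumes "P \<in> \<Q> n" shows "adapted n (indicator P)"
  unfolding adapted_def
proof (intro ballI)
  fix x y assume x: "x \<in> space M" and y: "y \<in> cell n x"
  have "y \<in> P \<longleftrightarrow> x \<in> P"
    using cell_eq[OF assms, of x] cell_eq[OF assms, of y] cell_cong[OF x y] cell(2)[OF x] y by auto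
  then show "indicator P y = indicator P x"
    by (simp add: indicator_def)
qed

text \<open>The \<open>L\<^sup>1\<close> closure of the integrable adapted functions, whose averages
  along a chain are eventually constant.\<close>

definition approximable :: "('a \<Rightarrow> complex) \<Rightarrow> bool" where
  "approximable h \<longleftrightarrow> (\<forall>e>0. \<exists>n g. integrable M g \<and> adapted n g \<and> (LINT x|M. norm (h x - g x)) < e)"

lemma approximableD:
  assumes "approximable h" "0 < e"
  obtains n g where "integrable M g" "adapted n g" "(LINT x|M. norm (h x - g x)) < e" "n\<^sub>0 \<le> n"
proof -
  obtain n g where "integrable M g" "adapted n g" "(LINT x|M. norm (h x - g x)) < e"
    using assms unfolding approximable_def by blast
  then show ?thesis
    using that[of g "max n n\<^sub>0"] adapted_mono[of n g "max n n\<^sub>0"] by simp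
qed

lemma approximable_adapted: "integrable M g \<Longrightarrow> adapted n g \<Longrightarrow> approximable g"
  unfolding approximable_def by (intro allI impI exI[of _ n] exI[of _ g]) simp

lemma approximable_add:
  assumes f: "integrable M f" "approximable f" and h: "integrable M h" "approximable h"
  shows "approximable (\<lambda>x. f x + h x)"
  unfolding approximable_def
proof (intro allI impI)
  fix e :: real assume "0 < e"
  then have e: "0 < e / 2" by simp
  obtain m g where g: "integrable M g" "adapted m g" "(LINT x|M. norm (f x - g x)) < e / 2"
    using approximableD[OF f(2) e] by metis
  obtain n k where k: "integrable M k" "adapted n k" "(LINT x|M. norm (h x - k x)) < e / 2"
    using approximableD[OF h(2) e] by metis
  have "(LINT x|M. norm (f x + h x - (g x + k x))) \<le> (LINT x|M. norm (f x - g x) + norm (h x - k x))"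
    using f h g k by (intro integral_mono) (auto simp: add_diff_add norm_triangle_ineq)
  also have "\<dots> < e"
    using f h g k by simp
  finally have "(LINT x|M. norm (f x + h x - (g x + k x))) < e" .
  moreover have "adapted (max m n) (\<lambda>x. g x + k x)"
    using adapted_mono[OF g(2), of "max m n"] adapted_mono[OF k(2), of "max m n"] by (simp add: adapted_def)
  ultimately show "\<exists>n g. integrable M g \<and> adapted n g \<and> (LINT x|M. norm (f x + h x - g x)) < e"
    using g(1) k(1) by (intro exI[of _ "max m n"] exI[of _ "\<lambda>x. g x + k x"]) simp
qed

lemma approximable_cmult:
  assumes "approximable h"
  shows "approximable (\<lambda>x. c * h x)"
  unfolding approximable_def
proof (intro allI impI)
  fix e :: real assume "0 < e"
  then have "0 < e / (norm c + 1)"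
    by (simp add: add_nonneg_pos)
  then obtain n g where g: "integrable M g" "adapted n g" "(LINT x|M. norm (h x - g x)) < e / (norm c + 1)"
    using approximableD[OF assms] by metis
  have "(LINT x|M. norm (c * h x - c * g x)) = norm c * (LINT x|M. norm (h x - g x))"
    by (simp add: norm_mult flip: right_diff_distrib)
  also have "\<dots> \<le> (norm c + 1) * (LINT x|M. norm (h x - g x))"
    by (intro mult_right_mono integral_nonneg_AE) auto
  also have "\<dots> < e"
    using g(3) by (simp add: pos_less_divide_eq add_nonneg_pos mult.commute)
  finally show "\<exists>n g. integrable M g \<and> adapted n g \<and> (LINT x|M. norm (c * h x - g x)) < e"
    using g(1,2) by (intro exI[of _ n] exI[of _ "\<lambda>x. c * g x"]) (auto simp: adapted_def)
qed

lemma approximable_lim: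
  assumes h: "integrable M h" and s: "\<And>i. integrable M (s i)" "\<And>i::nat. approximable (s i)"
    and lim: "\<And>x. x \<in> space M \<Longrightarrow> (\<lambda>i. s i x) \<longlonglongrightarrow> h x"
    and w: "integrable M w" "\<And>i x. x \<in> space M \<Longrightarrow> norm (s i x) \<le> (w x :: real)"
  shows "approximable h"
  unfolding approximable_def
proof (intro allI impI)
  fix e :: real assume "0 < e"
  then have e: "0 < e / 2" by simp
  have "(\<lambda>i. LINT x|M. norm (h x - s i x)) \<longlonglongrightarrow> (LINT x|M. 0)"
  proof (rule integral_dominated_convergence[where w = "\<lambda>x. norm (h x) + w x"])
    show "AE x in M. (\<lambda>i. norm (h x - s i x)) \<longlonglongrightarrow> 0"
    proof (rule AE_I2)
      fix x assume "x \<in> space M"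
      from tendsto_diff[OF tendsto_const lim[OF this], of "h x"]
      show "(\<lambda>i. norm (h x - s i x)) \<longlonglongrightarrow> 0"
        by (simp add: tendsto_norm_zero)
    qed
    show "AE x in M. norm (norm (h x - s i x)) \<le> norm (h x) + w x" for i
    proof (rule AE_I2)
      fix x assume "x \<in> space M"
      from w(2)[OF this, of i] show "norm (norm (h x - s i x)) \<le> norm (h x) + w x"
        using norm_triangle_ineq4[of "h x" "s i x"] by simp
    qed
  qed (use h s w in auto)
  then have "\<forall>\<^sub>F i in sequentially. (LINT x|M. norm (h x - s i x)) < e / 2"
    using e by (intro order_tendstoD(2)) auto
  then obtain i where i: "(LINT x|M. norm (h x - s i x)) < e / 2"
    by (auto dest: eventually_happens)
  obtain n g where g: "integrable M g" "adapted n g" "(LINT x|M. norm (s i x - g x)) < e / 2"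
    using approximableD[OF s(2) e] by metis
  have "(LINT x|M. norm (h x - g x)) \<le> (LINT x|M. norm (h x - s i x) + norm (s i x - g x))"
    using h s g norm_triangle_ineq[of "h x - s i x" "s i x - g x" for x]
    by (intro integral_mono) auto
  also have "\<dots> < e"
    using h s g i by simp
  finally show "\<exists>n g. integrable M g \<and> adapted n g \<and> (LINT x|M. norm (h x - g x)) < e"
    using g by blast
qed

lemma integrable_indicator_Int:
  assumes "P \<in> \<Q> n" "A \<in> sets M"
  shows "integrable M (indicator (A \<inter> P) :: 'a \<Rightarrow> complex)"
proof -
  have "A \<inter> P \<in> sets M"
    using assms cells_sets by auto
  moreover have "emeasure M (A \<inter> P) < \<infinity>"
    using emeasure_mono[of "A \<inter> P" P M] emeasure_cells[OF assms(1)] cells_sets[OF assms(1)]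
    by (meson Int_lower2 order_le_less_trans)
  ultimately have "integrable M (\<lambda>x. indicator (A \<inter> P) x *\<^sub>R (1 :: complex))"
    by (intro integrable_scaleR_left integrable_real_indicator)
  moreover have "(\<lambda>x. indicator (A \<inter> P) x *\<^sub>R (1 :: complex)) = indicator (A \<inter> P)"
    by (rule ext) (simp add: indicator_def)
  ultimately show ?thesis
    by simp
qed

text \<open>Dynkin's argument: cells are nested or disjoint, so with the empty set they form an
  intersection-stable generator. Intersecting with \<open>Q\<^sub>0\<close> keeps all indicators
  integrable, the measure being only sigma-finite.\<close>

lemma approximable_indicator:
  assumes Q\<^sub>0: "Q\<^sub>0 \<in> \<Q> n\<^sub>0" and A: "A \<in> sets M"
  shows "approximable (indicator (A \<inter> Q\<^sub>0))"
proof -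
  let ?G = "insert {} (\<Union>n. \<Q> n)"
  have cells_app: "approximable (indicator P)" if "P \<in> \<Q> n" for P n
    using approximable_adapted[OF _ adapted_indicator_cells[OF that]]
      integrable_indicator_Int[OF that cells_sets[OF that]] by simp
  have cells_Int: "P \<inter> Q = {} \<or> P \<inter> Q = P \<or> P \<inter> Q = Q" if "P \<in> \<Q> m" "Q \<in> \<Q> n" for P Q m n
    using cells_nested[OF cellsI[OF that(1)] cellsI[OF that(2)]] by blast
  have "(indicator {} :: 'a \<Rightarrow> complex) = (\<lambda>x. 0)"
    by (rule ext) simp
  moreover have zero: "approximable (\<lambda>x. 0)"
    by (rule approximable_adapted[of _ 0]) (auto simp: adapted_def)
  ultimately have empty: "approximable (indicator {})"
    by simp
  have "Int_stable ?G"
  proof (rule Int_stableI)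
    fix P Q assume PQ: "P \<in> ?G" "Q \<in> ?G"
    then consider "P = {} \<or> Q = {}" | m n where "P \<in> \<Q> m" "Q \<in> \<Q> n"
      by blast
    then have "P \<inter> Q = {} \<or> P \<inter> Q = P \<or> P \<inter> Q = Q"
      by cases (auto dest: cells_Int)
    then show "P \<inter> Q \<in> ?G"
      using PQ by (elim disjE) simp_all
  qed
  moreover have G_Pow: "?G \<subseteq> Pow (space M)"
    using cells_space by auto
  moreover have sets_eq: "sets M = sigma_sets (space M) ?G"
    unfolding generate_cells by (rule sigma_sets_eqI) (auto intro: sigma_sets.intros)
  then have "A \<in> sigma_sets (space M) ?G"
    using A by simp
  ultimately show ?thesis
  proof (induction rule: sigma_sets_induct_disjoint)
    case (basic A)
    then consider "A = {}" | n where "A \<in> \<Q> n"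
      by blast
    then show ?case
    proof cases
      case 2
      then consider "A \<inter> Q\<^sub>0 = {}" | "A \<inter> Q\<^sub>0 = A" | "A \<inter> Q\<^sub>0 = Q\<^sub>0"
        using cells_Int[OF 2 Q\<^sub>0] by blast
      then show ?thesis
        by cases (simp_all only: empty cells_app[OF 2] cells_app[OF Q\<^sub>0])
    qed (simp add: zero)
  next
    case empty
    then show ?case
      using zero by simp
  next
    case (compl A)
    then have A: "A \<in> sets M"
      using sets_eq by simp
    have "approximable (\<lambda>x. indicator Q\<^sub>0 x + - 1 * indicator (A \<inter> Q\<^sub>0) x)"
      using integrable_indicator_Int[OF Q\<^sub>0 cells_sets[OF Q\<^sub>0]] integrable_indicator_Int[OF Q\<^sub>0 A]
      by (intro approximable_add approximable_cmult cells_app[OF Q\<^sub>0] compl) auto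
    moreover have "indicator Q\<^sub>0 x + - 1 * indicator (A \<inter> Q\<^sub>0) x = (indicator ((space M - A) \<inter> Q\<^sub>0) x :: complex)" for x
      using cells_space[OF Q\<^sub>0] by (auto simp: indicator_def)
    ultimately show ?case
      by simp
  next
    case (union A)
    then have A: "A i \<in> sets M" for i
      using sets_eq by auto
    define s where "s n x = (\<Sum>i<n. indicator (A i \<inter> Q\<^sub>0) x :: complex)" for n x
    have s: "s n x = indicator ((\<Union>i<n. A i) \<inter> Q\<^sub>0) x" for n x
      unfolding s_def Int_commute[of _ Q\<^sub>0] indicator_inter_arith
      using union(1) by (subst indicator_UN_disjoint)
        (auto simp: disjoint_family_on_def sum_distrib_left)
    show ?case
    proof (rule approximable_lim[where s = s and w = "indicator Q\<^sub>0"])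
      show "integrable M (indicator ((\<Union>i. A i) \<inter> Q\<^sub>0) :: 'a \<Rightarrow> complex)"
        using A by (intro integrable_indicator_Int[OF Q\<^sub>0]) auto
      show "integrable M (s n)" for n
        unfolding s_def using integrable_indicator_Int[OF Q\<^sub>0 A] by (intro Bochner_Integration.integrable_sum)
      show "approximable (s n)" for n
      proof (induction n)
        case 0
        then show ?case
          using zero by (simp add: s_def)
      next
        case (Suc n)
        have "approximable (\<lambda>x. s n x + indicator (A n \<inter> Q\<^sub>0) x)"
          using Suc \<open>integrable M (s n)\<close> union(3) integrable_indicator_Int[OF Q\<^sub>0 A] by (intro approximable_add)
        then show ?case
          by (simp add: s_def)
      qed
      show "(\<lambda>i. s i x) \<longlonglongrightarrow> indicator ((\<Union>i. A i) \<inter> Q\<^sub>0) x" if "x \<in> space M" for x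
        unfolding s Int_commute[of _ Q\<^sub>0] indicator_inter_arith
        by (intro tendsto_intros LIMSEQ_indicator_UN)
      show "integrable M (indicator Q\<^sub>0 :: 'a \<Rightarrow> real)"
        using emeasure_cells[OF Q\<^sub>0] cells_sets[OF Q\<^sub>0] by (intro integrable_real_indicator) auto
      show "norm (s i x) \<le> indicator Q\<^sub>0 x" for i x
        unfolding s by (simp add: indicator_def)
    qed
  qed
qed

lemma approximable_integrable:
  assumes Q\<^sub>0: "Q\<^sub>0 \<in> \<Q> n\<^sub>0" and f: "integrable M f"
  shows "approximable (\<lambda>x. indicator Q\<^sub>0 x * f x)"
proof -
  have int: "integrable M (\<lambda>x. indicator Q\<^sub>0 x * g x)" if "integrable M g" for g :: "'a \<Rightarrow> complex"
  proof -
    have "(\<lambda>x. indicator Q\<^sub>0 x *\<^sub>R g x) = (\<lambda>x. indicator Q\<^sub>0 x * g x)"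
      by (rule ext) (simp add: indicator_def)
    then show ?thesis
      using integrable_mult_indicator[OF cells_sets[OF Q\<^sub>0] that] by simp
  qed
  show ?thesis
    using f
  proof (induction rule: integrable_induct)
    case (base A c)
    have "indicator Q\<^sub>0 x * indicator A x *\<^sub>R c = c * indicator (A \<inter> Q\<^sub>0) x" for x
      by (auto simp: indicator_def)
    then show ?case
      using approximable_cmult[OF approximable_indicator[OF Q\<^sub>0 base(1)], of c] by simp
  next
    case (add f g)
    then show ?case
      using approximable_add[OF int _ int] by (simp add: distrib_left)
  next
    case (lim f s)
    show ?case
    proof (rule approximable_lim)
      show "integrable M (\<lambda>x. indicator Q\<^sub>0 x * f x)" "integrable M (\<lambda>x. indicator Q\<^sub>0 x * s i x)"
          "approximable (\<lambda>x. indicator Q\<^sub>0 x * s i x)" for i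
        using lim int by auto
      show "(\<lambda>i. indicator Q\<^sub>0 x * s i x) \<longlonglongrightarrow> indicator Q\<^sub>0 x * f x" if "x \<in> space M" for x
        using lim.hyps(2)[OF that] by (intro tendsto_intros)
      show "norm (indicator Q\<^sub>0 x * s i x) \<le> 2 * norm (f x)" if "x \<in> space M" for i x
        using lim.hyps(3)[OF that, of i] by (auto simp: indicator_def)
      show "integrable M (\<lambda>x. 2 * norm (f x))"
        using lim by simp
    qed
  qed
qed

lemma approximable_supported:
  assumes Q\<^sub>0: "Q\<^sub>0 \<in> \<Q> n\<^sub>0" and supp: "AE x in M. x \<notin> Q\<^sub>0 \<longrightarrow> f x = 0" and f: "integrable M f"
  shows "approximable f"
proof -
  have [measurable]: "Q\<^sub>0 \<in> sets M" "f \<in> borel_measurable M"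
    using cells_sets[OF Q\<^sub>0] f by auto
  have "(LINT x|M. norm (indicator Q\<^sub>0 x * f x - g x)) = (LINT x|M. norm (f x - g x))"
    if "integrable M g" for g
  proof (rule integral_cong_AE)
    show "AE x in M. norm (indicator Q\<^sub>0 x * f x - g x) = norm (f x - g x)"
      using supp by eventually_elim (auto simp: indicator_def)
  qed (use borel_measurable_integrable[OF that] in measurable)
  then show ?thesis
    using approximable_integrable[OF Q\<^sub>0 f] unfolding approximable_def by metis
qed

section \<open>Oscillation of the partial sums at small scales\<close>

lemma average_diff:
  assumes "integrable M f" "integrable M g" "Q \<in> \<Q> n"
  shows "average M (\<lambda>x. f x - g x :: complex) Q = average M f Q - average M g Q"
  unfolding average_def
  using set_integral_diff(2)[OF set_integrable_cells[OF assms(1,3)] set_integrable_cells[OF assms(2,3)]]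
  by (simp add: scaleR_diff_right)

lemma average_adapted:
  assumes "adapted n g" "x \<in> space M" "n \<le> k"
  shows "average M g (cell k x) = (g x :: complex)"
proof -
  have Q: "cell k x \<in> \<Q> k"
    using cell(1)[OF assms(2)] .
  have "(LINT y:cell k x|M. g y) = (LINT y:cell k x|M. g x)"
    using cell_antimono[OF assms(2,3)] assms(1,2) cells_sets[OF Q]
    by (intro set_lebesgue_integral_cong) (auto simp: adapted_def)
  also have "\<dots> = measure M (cell k x) *\<^sub>R g x"
    unfolding set_lebesgue_integral_def
    using cells_sets[OF Q] emeasure_cells[OF Q] by (subst integral_scaleR_left) auto
  finally show ?thesis
    using measure_cells_pos[OF Q] by (simp add: average_def)
qed

text \<open>From level \<open>n\<close> on, the averages of \<open>g\<close> along the chain of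
  \<open>x\<close> stay at \<open>g x\<close>, so \<open>g\<close> contributes no
  differences.\<close>

lemma psum_minus_adapted:
  assumes f: "integrable M f" and g: "integrable M g" "adapted n g" and x: "x \<in> space M" and "n \<le> m"
  shows "psum \<epsilon> (\<lambda>y. f y - g y) m k x = psum \<epsilon> f m k x"
  unfolding psum_def
  using average_diff[OF f g(1) cell(1)[OF x]] average_adapted[OF g(2) x] \<open>n \<le> m\<close>
  by (intro sum.cong) auto

text \<open>Subtracting a close adapted function does not change the oscillation at small scales,
  and the weak type bound for the remainder makes the exceptional set small. That set is only
  covered by measurable sets, which avoids proving it measurable.\<close>

lemma psum_oscillation_null:
  assumes Q\<^sub>0: "Q\<^sub>0 \<in> \<Q> n\<^sub>0" and f: "integrable M f" "approximable f"
    and \<epsilon>: "\<forall>P\<in>cells \<Q>. norm (\<epsilon> P) \<le> 1" and c: "0 < c"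
  shows "AE x in M. x \<in> Q\<^sub>0 \<longrightarrow> (\<exists>N\<ge>n\<^sub>0. \<forall>j\<ge>N. \<forall>k\<ge>N. norm (psum \<epsilon> f n\<^sub>0 k x - psum \<epsilon> f n\<^sub>0 j x) < 2 * c)"
proof -
  define Z where "Z = {x \<in> Q\<^sub>0. \<forall>N\<ge>n\<^sub>0. \<exists>j\<ge>N. \<exists>k\<ge>N. 2 * c \<le> norm (psum \<epsilon> f n\<^sub>0 k x - psum \<epsilon> f n\<^sub>0 j x)}"
  have "\<exists>W\<in>sets M. Z \<subseteq> W \<and> emeasure M W \<le> ennreal e" if "0 < e" for e
  proof -
    \<comment> \<open>Chosen so that the factor \<open>3 / c\<close> of the weak type bound turns it
      into \<open>e\<close>.\<close>
    have "0 < e * c / 3"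
      using that c by simp
    then obtain n g where g: "integrable M g" "adapted n g" "(LINT x|M. norm (f x - g x)) < e * c / 3" "n\<^sub>0 \<le> n"
      using approximableD[OF f(2)] by metis
    define h where "h = (\<lambda>x. f x - g x)"
    have h: "integrable M h"
      using f(1) g(1) by (simp add: h_def)
    define W where "W = {x \<in> Q\<^sub>0. \<exists>k\<ge>n\<^sub>0. c \<le> norm (psum \<epsilon> h n\<^sub>0 k x) \<or> c \<le> avg h (cell k x)}"
    have W: "W \<in> sets M" "measure M W \<le> 3 / c * (LINT x:Q\<^sub>0|M. norm (h x))"
      unfolding W_def using weak_type[OF h \<epsilon> Q\<^sub>0 c] by simp_all
    have "(LINT x:Q\<^sub>0|M. norm (h x)) \<le> (LINT x|M. norm (h x))"
      unfolding set_lebesgue_integral_def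
      using integrable_mult_indicator[OF cells_sets[OF Q\<^sub>0] integrable_norm[OF h]] integrable_norm[OF h]
      by (intro integral_mono) (auto simp: indicator_def)
    also have "\<dots> \<le> e * c / 3"
      using g(3) by (simp add: h_def)
    finally have "3 / c * (LINT x:Q\<^sub>0|M. norm (h x)) \<le> 3 / c * (e * c / 3)"
      using c by (intro mult_left_mono) simp_all
    then have "measure M W \<le> e"
      using W(2) c by simp
    moreover have "emeasure M W \<noteq> \<infinity>"
      using emeasure_mono[of W Q\<^sub>0 M] emeasure_cells[OF Q\<^sub>0] cells_sets[OF Q\<^sub>0] by (auto simp: W_def top_unique)
    ultimately have "emeasure M W \<le> ennreal e"
      by (simp add: emeasure_eq_ennreal_measure ennreal_leI)
    moreover have "Z \<subseteq> W"
    proof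
      fix x assume "x \<in> Z"
      then obtain j k where x: "x \<in> Q\<^sub>0" and jk: "n \<le> j" "n \<le> k"
          "2 * c \<le> norm (psum \<epsilon> f n\<^sub>0 k x - psum \<epsilon> f n\<^sub>0 j x)"
        using g(4) unfolding Z_def by blast
      have xs: "x \<in> space M"
        using x cells_space[OF Q\<^sub>0] by blast
      \<comment> \<open>\<open>W\<close> is defined by sums started at \<open>n\<^sub>0\<close>,
        whereas \<open>f\<close> and \<open>h\<close> agree only in sums started at
        \<open>n\<close>. The difference of two sums does not depend on the start.\<close>
      have "psum \<epsilon> f n\<^sub>0 k x - psum \<epsilon> f n\<^sub>0 j x = psum \<epsilon> f n k x - psum \<epsilon> f n j x"
        using psum_add[OF g(4) jk(1), of \<epsilon> f x] psum_add[OF g(4) jk(2), of \<epsilon> f x] by simp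
      also have "\<dots> = psum \<epsilon> h n k x - psum \<epsilon> h n j x"
        using psum_minus_adapted[OF f(1) g(1,2) xs order_refl] by (simp add: h_def)
      also have "\<dots> = psum \<epsilon> h n\<^sub>0 k x - psum \<epsilon> h n\<^sub>0 j x"
        using psum_add[OF g(4) jk(1), of \<epsilon> h x] psum_add[OF g(4) jk(2), of \<epsilon> h x] by simp
      finally have "2 * c \<le> norm (psum \<epsilon> h n\<^sub>0 k x) + norm (psum \<epsilon> h n\<^sub>0 j x)"
        using jk(3) norm_triangle_ineq4[of "psum \<epsilon> h n\<^sub>0 k x" "psum \<epsilon> h n\<^sub>0 j x"] by simp
      then have "c \<le> norm (psum \<epsilon> h n\<^sub>0 k x) \<or> c \<le> norm (psum \<epsilon> h n\<^sub>0 j x)"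
        by linarith
      then show "x \<in> W"
        using x jk(1,2) g(4) unfolding W_def by (auto intro: order_trans)
    qed
    ultimately show ?thesis
      using W(1) by blast
  qed
  then have "\<exists>W. \<forall>i. W i \<in> sets M \<and> Z \<subseteq> W i \<and> emeasure M (W i) \<le> ennreal (1 / real (Suc i))"
    by (intro choice allI) (auto simp: Bex_def)
  then obtain W where W: "\<And>i. W i \<in> sets M" "\<And>i. Z \<subseteq> W i" "\<And>i. emeasure M (W i) \<le> ennreal (1 / real (Suc i))"
    by blast
  have "emeasure M (\<Inter>i. W i) \<le> ennreal (1 / real (Suc i))" for i
    using W(3)[of i] emeasure_mono[of "\<Inter>i. W i" "W i" M] W(1) by (meson INT_lower UNIV_I order_trans)
  moreover have "(\<lambda>i. ennreal (1 / real (Suc i))) \<longlonglongrightarrow> ennreal 0"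
    using LIMSEQ_inverse_real_of_nat by (intro tendsto_ennrealI) (simp add: inverse_eq_divide)
  ultimately have "emeasure M (\<Inter>i. W i) \<le> ennreal 0"
    by (intro LIMSEQ_le_const) auto
  then have "(\<Inter>i. W i) \<in> null_sets M"
    using W(1) by (intro null_setsI) auto
  then have "AE x in M. x \<notin> (\<Inter>i. W i)"
    by (rule AE_not_in)
  then show ?thesis
  proof eventually_elim
    case (elim x)
    then have "x \<notin> Z"
      using W(2) by auto
    then show ?case
      unfolding Z_def mem_Collect_eq by (meson linorder_not_le)
  qed
qed

text \<open>Countably many thresholds \<open>2 / Suc i\<close> hold simultaneously almost everywhere
  and make the sums Cauchy.\<close>

lemma psum_tendsto_at_top:
  assumes Q\<^sub>0: "Q\<^sub>0 \<in> \<Q> n\<^sub>0" and supp: "AE x in M. x \<notin> Q\<^sub>0 \<longrightarrow> f x = 0" and f: "integrable M f"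
    and \<epsilon>: "\<forall>P\<in>cells \<Q>. norm (\<epsilon> P) \<le> 1"
  shows "AE x in M. x \<in> Q\<^sub>0 \<longrightarrow> (\<exists>l. ((\<lambda>n. psum \<epsilon> f n\<^sub>0 n x) \<longlongrightarrow> l) at_top)"
proof -
  have "AE x in M. \<forall>i::nat. x \<in> Q\<^sub>0 \<longrightarrow> (\<exists>N\<ge>n\<^sub>0. \<forall>j\<ge>N. \<forall>k\<ge>N.
      norm (psum \<epsilon> f n\<^sub>0 k x - psum \<epsilon> f n\<^sub>0 j x) < 2 * (1 / real (Suc i)))"
    unfolding AE_all_countable
    by (intro allI psum_oscillation_null[OF Q\<^sub>0 f approximable_supported[OF Q\<^sub>0 supp f] \<epsilon>]) simp
  then show ?thesis
  proof eventually_elim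
    case (elim x)
    show ?case
    proof
      assume x: "x \<in> Q\<^sub>0"
      define s where "s j = psum \<epsilon> f n\<^sub>0 (n\<^sub>0 + int j) x" for j
      have "Cauchy s"
      proof (rule metric_CauchyI)
        fix e :: real assume "0 < e"
        then obtain i where i: "1 / real (Suc i) < e / 2"
          using nat_approx_posE[of "e / 2"] by auto
        obtain N where N: "n\<^sub>0 \<le> N" "\<And>j k. N \<le> j \<Longrightarrow> N \<le> k \<Longrightarrow>
            norm (psum \<epsilon> f n\<^sub>0 k x - psum \<epsilon> f n\<^sub>0 j x) < 2 * (1 / real (Suc i))"
          using elim x by metis
        have "dist (s j) (s k) < e" if "nat (N - n\<^sub>0) \<le> j" "nat (N - n\<^sub>0) \<le> k" for j k
        proof -
          have "N \<le> n\<^sub>0 + int k" "N \<le> n\<^sub>0 + int j"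
            using that by linarith+
          from N(2)[OF this] show ?thesis
            unfolding dist_norm s_def using i by linarith
        qed
        then show "\<exists>N. \<forall>j\<ge>N. \<forall>k\<ge>N. dist (s j) (s k) < e"
          by blast
      qed
      then obtain l where "s \<longlonglongrightarrow> l"
        using Cauchy_convergent convergent_def by blast
      moreover have "filterlim (\<lambda>n. nat (n - n\<^sub>0)) sequentially at_top"
        unfolding filterlim_at_top
      proof
        fix Z
        show "\<forall>\<^sub>F n in at_top. Z \<le> nat (n - n\<^sub>0)"
          using eventually_ge_at_top[of "n\<^sub>0 + int Z"] by eventually_elim simp
      qed
      ultimately have "((\<lambda>n. s (nat (n - n\<^sub>0))) \<longlongrightarrow> l) at_top"
        by (rule filterlim_compose)
      moreover have "\<forall>\<^sub>F n in at_top. s (nat (n - n\<^sub>0)) = psum \<epsilon> f n\<^sub>0 n x"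
        using eventually_ge_at_top[of n\<^sub>0] by eventually_elim (simp add: s_def)
      ultimately have "((\<lambda>n. psum \<epsilon> f n\<^sub>0 n x) \<longlongrightarrow> l) at_top"
        by (rule Lim_transform_eventually)
      then show "\<exists>l. ((\<lambda>n. psum \<epsilon> f n\<^sub>0 n x) \<longlongrightarrow> l) at_top"
        by (rule exI)
    qed
  qed
qed

subsection \<open>Sparse domination\<close>

lemma transform_partial_sum_eq_psum:
  assumes x: "x \<in> space M" and "m \<le> n"
  obtains n' where "n \<le> n'" "transform_partial_sum M \<Q> \<epsilon> f x (m, n) = psum \<epsilon> f m n' x"
proof -
  have "{P. P \<in> (\<Union>k\<in>{m..n}. \<Q> k) \<and> x \<in> P} = (\<lambda>k. cell k x) ` {m..n}"
  proof safe
    fix P k assume "k \<in> {m..n}" "P \<in> \<Q> k" "x \<in> P"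
    then show "P \<in> (\<lambda>k. cell k x) ` {m..n}"
      using cell_eq[of P k x] by blast
  qed (use cell[OF x] in blast)+
  then have "transform_partial_sum M \<Q> \<epsilon> f x (m, n)
      = (\<Sum>P\<in>(\<lambda>k. cell k x) ` {m..n}. \<epsilon> P * mart_diff M \<Q> P f x)"
    by (simp add: transform_partial_sum_def)
  then show ?thesis
    using sum_mart_diff_eq_psum[OF assms, of \<epsilon> f] that by metis
qed

lemma transform_partial_sum_tendsto:
  assumes x: "x \<in> space M" and bot: "((\<lambda>m. psum \<epsilon> f m n\<^sub>0 x) \<longlongrightarrow> a) at_bot"
    and top: "((\<lambda>n. psum \<epsilon> f n\<^sub>0 n x) \<longlongrightarrow> b) at_top"
  shows "(transform_partial_sum M \<Q> \<epsilon> f x \<longlongrightarrow> a + b) (at_bot \<times>\<^sub>F at_top)"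
proof (rule tendstoI)
  fix e :: real assume "0 < e"
  then have e: "0 < e / 2" by simp
  have m_ev: "\<forall>\<^sub>F m in at_bot. dist (psum \<epsilon> f m n\<^sub>0 x) a < e / 2 \<and> m \<le> n\<^sub>0"
    using tendstoD[OF bot e] eventually_le_at_bot[of n\<^sub>0] by (rule eventually_conj)
  obtain N where N: "\<And>n. N \<le> n \<Longrightarrow> dist (psum \<epsilon> f n\<^sub>0 n x) b < e / 2"
    using tendstoD[OF top e] unfolding eventually_at_top_linorder by blast
  have "\<forall>\<^sub>F p in at_bot \<times>\<^sub>F at_top. (dist (psum \<epsilon> f (fst p) n\<^sub>0 x) a < e / 2 \<and> fst p \<le> n\<^sub>0) \<and> max N n\<^sub>0 \<le> snd p"
    by (rule eventually_prodI[OF m_ev eventually_ge_at_top])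
  then show "\<forall>\<^sub>F p in at_bot \<times>\<^sub>F at_top. dist (transform_partial_sum M \<Q> \<epsilon> f x p) (a + b) < e"
  proof eventually_elim
    case (elim p)
    obtain m n where p: "p = (m, n)"
      by (cases p)
    have mn: "m \<le> n\<^sub>0" "N \<le> n" "n\<^sub>0 \<le> n" "dist (psum \<epsilon> f m n\<^sub>0 x) a < e / 2"
      using elim by (auto simp: p)
    \<comment> \<open>The upper end moves from \<open>n\<close> to an unknown later
      \<open>n'\<close>; this is harmless since the estimate with \<open>N\<close> holds for all
      later levels.\<close>
    obtain n' where n': "n \<le> n'" "transform_partial_sum M \<Q> \<epsilon> f x (m, n) = psum \<epsilon> f m n' x"
      using transform_partial_sum_eq_psum[OF x, of m n \<epsilon> f] mn by (metis order_trans)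
    have "psum \<epsilon> f m n' x = psum \<epsilon> f m n\<^sub>0 x + psum \<epsilon> f n\<^sub>0 n' x"
      using mn n'(1) by (intro psum_add) auto
    moreover have "dist (psum \<epsilon> f n\<^sub>0 n' x) b < e / 2"
      using N mn(2) n'(1) by simp
    ultimately show ?case
      using mn(4) n'(2) dist_triangle_add[of "psum \<epsilon> f m n\<^sub>0 x" "psum \<epsilon> f n\<^sub>0 n' x" a b] by (simp add: p)
  qed
qed

lemma psum_outside_support:
  assumes supp: "AE x in M. x \<notin> Q\<^sub>0 \<longrightarrow> f x = 0" and f: "integrable M f"
    and Q\<^sub>0: "Q\<^sub>0 \<in> \<Q> n\<^sub>0" and x: "x \<in> space M" "x \<notin> Q\<^sub>0"
  shows "psum \<epsilon> f n\<^sub>0 n x = 0"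
proof -
  have "average M f (cell k x) = 0" if "n\<^sub>0 \<le> k" for k
  proof -
    have "Q\<^sub>0 \<inter> cell n\<^sub>0 x = {}"
      using disjointD[OF disjoint_cells Q\<^sub>0 cell(1)[OF x(1)]] cell(2)[OF x(1)] x(2) by metis
    then have "Q\<^sub>0 \<inter> cell k x = {}"
      using cell_antimono[OF x(1) that] by blast
    then show ?thesis
      using set_integral_supported(2)[OF supp f cells_sets[OF cell(1)[OF x(1)]]] by (simp add: average_def)
  qed
  then show ?thesis
    unfolding psum_def by (intro sum.neutral) simp
qed

text \<open>The claim concerns the whole space. Off \<open>Q\<^sub>0\<close> the sums below level
  \<open>n\<^sub>0\<close> vanish, and only the limit towards large cells remains.\<close>

lemma AE_transform_converges:
  assumes supp: "AE x in M. x \<notin> Q\<^sub>0 \<longrightarrow> f x = 0" and f: "integrable M f"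
    and \<epsilon>: "\<forall>P\<in>cells \<Q>. norm (\<epsilon> P) \<le> 1" and Q\<^sub>0: "Q\<^sub>0 \<in> \<Q> n\<^sub>0"
  shows "AE x in M. transform_converges M \<Q> \<epsilon> f x"
  using AE_space psum_tendsto_at_top[OF Q\<^sub>0 supp f \<epsilon>]
proof eventually_elim
  case (elim x)
  obtain a where a: "((\<lambda>m. psum \<epsilon> f m n\<^sub>0 x) \<longlongrightarrow> a) at_bot"
    using psum_tendsto_at_bot[OF supp f \<epsilon> Q\<^sub>0 elim(1)] by metis
  obtain b where b: "((\<lambda>n. psum \<epsilon> f n\<^sub>0 n x) \<longlongrightarrow> b) at_top"
  proof (cases "x \<in> Q\<^sub>0")
    case False
    then have "((\<lambda>n. psum \<epsilon> f n\<^sub>0 n x) \<longlongrightarrow> 0) at_top"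
      using psum_outside_support[OF supp f Q\<^sub>0 elim(1)] by simp
    then show ?thesis
      by (rule that)
  qed (use elim(2) that in blast)
  show ?case
    unfolding transform_converges_def using transform_partial_sum_tendsto[OF elim(1) a b] by blast
qed

text \<open>Holds at every point of \<open>Q\<^sub>0\<close>; exceptional null sets enter only
  through the convergence of the transform.\<close>

lemma sparse_bounds:
  assumes supp: "AE x in M. x \<notin> Q\<^sub>0 \<longrightarrow> f x = 0" and f: "integrable M f"
    and \<epsilon>: "\<forall>P\<in>cells \<Q>. norm (\<epsilon> P) \<le> 1" and Q\<^sub>0: "Q\<^sub>0 \<in> \<Q> n\<^sub>0" and x: "x \<in> Q\<^sub>0"
  defines "X \<equiv> 14 * sparse_operator M (stopping_family \<epsilon> f n\<^sub>0 Q\<^sub>0) (\<lambda>y. norm (f y)) x"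
  shows "max_truncation M \<Q> \<epsilon> f x \<le> X"
    and "transform_converges M \<Q> \<epsilon> f x \<Longrightarrow> ennreal (norm (mart_transform M \<Q> \<epsilon> f x)) \<le> X"
proof -
  have xs: "x \<in> space M"
    using x cells_space[OF Q\<^sub>0] by blast
  \<comment> \<open>Infinitely many stopping cells may contain \<open>x\<close>, and then the sparse
    operator can be infinite. Elsewhere a real bound on all partial sums passes to suprema and
    limits.\<close>
  consider "X = top" | "X < top"
    using top.not_eq_extremum by blast
  then have "max_truncation M \<Q> \<epsilon> f x \<le> X \<and>
      (transform_converges M \<Q> \<epsilon> f x \<longrightarrow> ennreal (norm (mart_transform M \<Q> \<epsilon> f x)) \<le> X)"
  proof cases
    case 2
    define B where "B = enn2real X"
    have X: "X = ennreal B" and "0 \<le> B"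
      using 2 by (simp_all add: B_def)
    have B: "norm (psum \<epsilon> f m n x) \<le> B" if "m \<le> n\<^sub>0" for m n
    proof -
      have "ennreal (norm (psum \<epsilon> f n\<^sub>0 n x) + avg f Q\<^sub>0) \<le> ennreal B"
        unfolding X[symmetric] X_def by (rule psum_sparse_bound[OF f \<epsilon> Q\<^sub>0 x])
      then have "norm (psum \<epsilon> f n\<^sub>0 n x) + avg f Q\<^sub>0 \<le> B"
        using \<open>0 \<le> B\<close> by simp
      then show ?thesis
        using psum_top_bound[OF supp f \<epsilon> Q\<^sub>0 x that, of n] by linarith
    qed
    have "max_truncation M \<Q> \<epsilon> f x \<le> X"
      unfolding max_truncation_def X
      using norm_truncation_le[OF xs _ B \<open>0 \<le> B\<close>] by (intro SUP_least ennreal_leI) blast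
    moreover have "ennreal (norm (mart_transform M \<Q> \<epsilon> f x)) \<le> X" if conv: "transform_converges M \<Q> \<epsilon> f x"
    proof -
      obtain l where l: "(transform_partial_sum M \<Q> \<epsilon> f x \<longlongrightarrow> l) (at_bot \<times>\<^sub>F at_top)"
        using conv unfolding transform_converges_def by blast
      have nontrivial: "(at_bot \<times>\<^sub>F at_top :: (int \<times> int) filter) \<noteq> bot"
        by (simp add: prod_filter_eq_bot)
      have "\<forall>\<^sub>F p in at_bot \<times>\<^sub>F at_top. fst p \<le> n\<^sub>0 \<and> n\<^sub>0 \<le> snd p"
        by (rule eventually_prodI[OF eventually_le_at_bot eventually_ge_at_top])
      then have "\<forall>\<^sub>F p in at_bot \<times>\<^sub>F at_top. norm (transform_partial_sum M \<Q> \<epsilon> f x p) \<le> B"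
      proof eventually_elim
        case (elim p)
        then obtain n' where "transform_partial_sum M \<Q> \<epsilon> f x p = psum \<epsilon> f (fst p) n' x"
          using transform_partial_sum_eq_psum[OF xs, of "fst p" "snd p" \<epsilon> f] by (metis order_trans prod.collapse)
        then show ?case
          using B elim by simp
      qed
      then have "norm l \<le> B"
        using tendsto_upperbound[OF tendsto_norm[OF l]] nontrivial by blast
      then show ?thesis
        using tendsto_Lim[OF nontrivial l] by (simp add: mart_transform_def X ennreal_leI)
    qed
    ultimately show ?thesis
      by blast
  qed simp
  then show "max_truncation M \<Q> \<epsilon> f x \<le> X"
    and "transform_converges M \<Q> \<epsilon> f x \<Longrightarrow> ennreal (norm (mart_transform M \<Q> \<epsilon> f x)) \<le> X"
    by blast+
qed

end

theorem theorem2p4: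
  fixes M :: "'a measure" and \<Q> :: "int \<Rightarrow> 'a set set"
  assumes "partition_filtration M \<Q>"
  shows "\<exists>C::real. C > 0 \<and>
    (\<forall>Q\<^sub>0 \<in> cells \<Q>. \<forall>(f :: 'a \<Rightarrow> complex) (\<epsilon> :: 'a set \<Rightarrow> complex).
      integrable M f \<longrightarrow> (AE x in M. x \<notin> Q\<^sub>0 \<longrightarrow> f x = 0) \<longrightarrow>
      (\<forall>P \<in> cells \<Q>. norm (\<epsilon> P) \<le> 1) \<longrightarrow>
        (AE x in M. transform_converges M \<Q> \<epsilon> f x) \<and>
        (\<exists>\<S>. sparse_family M \<Q> \<S> \<and>
          (AE x in M. indicator Q\<^sub>0 x * ennreal (norm (mart_transform M \<Q> \<epsilon> f x))
             \<le> ennreal C * sparse_operator M \<S> (\<lambda>y. norm (f y)) x)) \<and>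
        (\<exists>\<S>. sparse_family M \<Q> \<S> \<and>
          (AE x in M. indicator Q\<^sub>0 x * max_truncation M \<Q> \<epsilon> f x
             \<le> ennreal C * sparse_operator M \<S> (\<lambda>y. norm (f y)) x)))"
proof -
  interpret partition_filtration M \<Q>
    by (rule assms)
  show ?thesis
  proof (intro exI[of _ 14] conjI ballI allI impI)
    fix Q\<^sub>0 and f :: "'a \<Rightarrow> complex" and \<epsilon> :: "'a set \<Rightarrow> complex"
    assume "Q\<^sub>0 \<in> cells \<Q>" and f: "integrable M f" and supp: "AE x in M. x \<notin> Q\<^sub>0 \<longrightarrow> f x = 0"
      and \<epsilon>: "\<forall>P\<in>cells \<Q>. norm (\<epsilon> P) \<le> 1"
    then obtain n\<^sub>0 where Q\<^sub>0: "Q\<^sub>0 \<in> \<Q> n\<^sub>0"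
      by (auto simp: cells_def)
    \<comment> \<open>One family serves both claims, and any level at which \<open>Q\<^sub>0\<close>
      occurs may be taken as \<open>n\<^sub>0\<close>.\<close>
    let ?S = "stopping_family \<epsilon> f n\<^sub>0 Q\<^sub>0"
    have sparse: "sparse_family M \<Q> ?S"
      by (rule sparse_stopping_family[OF f \<epsilon> Q\<^sub>0])
    show conv: "AE x in M. transform_converges M \<Q> \<epsilon> f x"
      by (rule AE_transform_converges[OF supp f \<epsilon> Q\<^sub>0])
    have "AE x in M. indicator Q\<^sub>0 x * ennreal (norm (mart_transform M \<Q> \<epsilon> f x))
        \<le> ennreal 14 * sparse_operator M ?S (\<lambda>y. norm (f y)) x"
      using conv
    proof eventually_elim
      case (elim x)
      then show ?case
        using sparse_bounds(2)[OF supp f \<epsilon> Q\<^sub>0, of x] by (cases "x \<in> Q\<^sub>0") simp_all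
    qed
    then show "\<exists>\<S>. sparse_family M \<Q> \<S> \<and>
        (AE x in M. indicator Q\<^sub>0 x * ennreal (norm (mart_transform M \<Q> \<epsilon> f x))
          \<le> ennreal 14 * sparse_operator M \<S> (\<lambda>y. norm (f y)) x)"
      using sparse by blast
    have "indicator Q\<^sub>0 x * max_truncation M \<Q> \<epsilon> f x
        \<le> ennreal 14 * sparse_operator M ?S (\<lambda>y. norm (f y)) x" for x
      using sparse_bounds(1)[OF supp f \<epsilon> Q\<^sub>0, of x] by (cases "x \<in> Q\<^sub>0") simp_all
    then show "\<exists>\<S>. sparse_family M \<Q> \<S> \<and>
        (AE x in M. indicator Q\<^sub>0 x * max_truncation M \<Q> \<epsilon> f x
          \<le> ennreal 14 * sparse_operator M \<S> (\<lambda>y. norm (f y)) x)"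
      using sparse by blast
  qed simp
qed

end
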